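(* Let $X$ be a Hilbert space and $A:D(A)\subset X\to X$ be self-adjoint and bounded from below. Let $\overline k\ge0$ be such that $\mathrm{re}\,\sigma(A+\overline kI)>0$ and let $X^\beta$, $\beta\in\mathbb R$, be the fractional power spaces generated by $A+\overline kI$. Let $\alpha\in[0,1)$, let $g:X^\alpha\to X$ be Lipschitz on bounded subsets of $X^\alpha$ and let $\pi$ be the local semiflow on $X^\alpha$ generated by the solutions of $\dot u+Au=g(u)$. If $K\subset X^\alpha$ is a $\pi$-invariant set which is compact in $X^\alpha$, then $K\subset X^1=D(A)$ and $K$ is compact in $X^1$.
   Context: For $\beta\ge0$, $X^\beta=D((A+\overline kI)^\beta)$ with norm $|(A+\overline kI)^\beta u|_X$; for $\beta>0$, $X^{-\beta}$ is the dual of $X^\beta$. Solutions of $\dot u+Au=g(u)$ are continuous maps $u:I\to X^\alpha$ satisfying the variation of constants formula $u(t)=e^{-A(t-t_0)}u(t_0)+\int_{t_0}^te^{-A(t-s)}g(u(s))ds$ for $t_0\le t$ in $I$. A set $K$ is $\pi$-invariant if for every $x\in K$ there is a solution $\sigma:\mathbb R\to X^\alpha$ with $\sigma(\mathbb R)\subset K$ and $\sigma(0)=x$. *)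

theory Defs
  imports "HOL-Analysis.Analysis"
begin

text \<open>Unbounded operators on a (real) Hilbert space are represented by a domain
  set D and a function A (whose values outside D are irrelevant).\<close>

definition self_adjoint_op :: "'a::{real_inner,complete_space} set \<Rightarrow> ('a \<Rightarrow> 'a) \<Rightarrow> bool" where
  "self_adjoint_op D A \<longleftrightarrow>
     subspace D \<and> closure D = UNIV \<and>
     (\<forall>x\<in>D. \<forall>y\<in>D. A (x + y) = A x + A y) \<and>
     (\<forall>x\<in>D. \<forall>c::real. A (c *\<^sub>R x) = c *\<^sub>R A x) \<and>
     (\<forall>x\<in>D. \<forall>y\<in>D. inner (A x) y = inner x (A y)) \<and>
     (\<forall>y z. (\<forall>x\<in>D. inner (A x) y = inner x z) \<longrightarrow> y \<in> D \<and> A y = z)"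

definition bounded_below_op :: "'a::real_inner set \<Rightarrow> ('a \<Rightarrow> 'a) \<Rightarrow> bool" where
  "bounded_below_op D A \<longleftrightarrow> (\<exists>c::real. \<forall>x\<in>D. inner (A x) x \<ge> c * (norm x)\<^sup>2)"

definition op_resolvent_set :: "'a::real_normed_vector set \<Rightarrow> ('a \<Rightarrow> 'a) \<Rightarrow> real set" where
  "op_resolvent_set D A = {l. bij_betw (\<lambda>x. A x - l *\<^sub>R x) D UNIV \<and>
                                  bounded_linear (inv_into D (\<lambda>x. A x - l *\<^sub>R x))}"

definition op_spectrum :: "'a::real_normed_vector set \<Rightarrow> ('a \<Rightarrow> 'a) \<Rightarrow> real set" where
  "op_spectrum D A = UNIV - op_resolvent_set D A"

text \<open>Negative fractional power B^(-beta), 0 \<le> \<beta> < 1, of a positive operator B with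
  domain D, via Balakrishnan's formula
  B^(-\<beta>) x = sin(\<pi>\<beta>)/\<pi> \<integral>_0^\<infinity> t^(-\<beta>) (t + B)^(-1) x dt.\<close>

definition frac_neg_power :: "'a::{real_normed_vector} set \<Rightarrow> ('a \<Rightarrow> 'a) \<Rightarrow> real \<Rightarrow> 'a \<Rightarrow> 'a" where
  "frac_neg_power D B \<beta> x =
     (if \<beta> = 0 then x
      else (sin (pi * \<beta>) / pi) *\<^sub>R
             integral {0<..} (\<lambda>t. t powr (- \<beta>) *\<^sub>R inv_into D (\<lambda>y. B y + t *\<^sub>R y) x))"

text \<open>The fractional power space X^\<beta> = D(B^\<beta>) = range of B^(-\<beta>), and B^\<beta> on it.\<close>

definition frac_space :: "'a::{real_normed_vector} set \<Rightarrow> ('a \<Rightarrow> 'a) \<Rightarrow> real \<Rightarrow> 'a set" where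
  "frac_space D B \<beta> = range (frac_neg_power D B \<beta>)"

definition frac_pow :: "'a::{real_normed_vector} set \<Rightarrow> ('a \<Rightarrow> 'a) \<Rightarrow> real \<Rightarrow> 'a \<Rightarrow> 'a" where
  "frac_pow D B \<beta> u = inv_into UNIV (frac_neg_power D B \<beta>) u"

text \<open>The semigroup e^(-tA), t \<ge> 0, via the exponential formula
  e^(-tA) x = lim_n (I + (t/n) A)^(-n) x.\<close>

definition op_semigroup :: "'a::{real_normed_vector} set \<Rightarrow> ('a \<Rightarrow> 'a) \<Rightarrow> real \<Rightarrow> 'a \<Rightarrow> 'a" where
  "op_semigroup D A t x =
     (if t = 0 then x
      else lim (\<lambda>n. ((inv_into D (\<lambda>y. y + (t / real n) *\<^sub>R A y)) ^^ n) x))"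

text \<open>Solutions of u' + Au = g(u) on an interval I: continuous maps I \<rightarrow> X^\<alpha>
  satisfying the variation of constants formula.\<close>

definition is_solution ::
  "'a::{real_normed_vector} set \<Rightarrow> ('a \<Rightarrow> 'a) \<Rightarrow> real \<Rightarrow> real \<Rightarrow> ('a \<Rightarrow> 'a) \<Rightarrow> real set \<Rightarrow> (real \<Rightarrow> 'a) \<Rightarrow> bool" where
  "is_solution D A kbar \<alpha> g I u \<longleftrightarrow>
     (let B = (\<lambda>x. A x + kbar *\<^sub>R x) in
       (\<forall>t\<in>I. u t \<in> frac_space D B \<alpha>) \<and>
       continuous_on I (\<lambda>t. frac_pow D B \<alpha> (u t)) \<and>
       (\<forall>t0\<in>I. \<forall>t\<in>I. t0 \<le> t \<longrightarrow>
          ((\<lambda>s. op_semigroup D A (t - s) (g (u s))) has_integral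
             (u t - op_semigroup D A (t - t0) (u t0))) {t0..t}))"

definition pi_invariant ::
  "'a::{real_normed_vector} set \<Rightarrow> ('a \<Rightarrow> 'a) \<Rightarrow> real \<Rightarrow> real \<Rightarrow> ('a \<Rightarrow> 'a) \<Rightarrow> 'a set \<Rightarrow> bool" where
  "pi_invariant D A kbar \<alpha> g K \<longleftrightarrow>
     (\<forall>x\<in>K. \<exists>\<sigma>. is_solution D A kbar \<alpha> g UNIV \<sigma> \<and> range \<sigma> \<subseteq> K \<and> \<sigma> 0 = x)"

end

theory Submission
  imports Defs "HOL-Computational_Algebra.Polynomial"
begin

text \<open>
  Put \<open>B = A + k\<close>. The spectral hypothesis makes \<open>R = inverse B\<close> a bounded symmetric operator with
  \<open>0 \<le> R \<le> c\<close>, so every operator in the statement is a continuous function of \<open>R\<close>: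
  \<open>(B + t) powr (-1)\<close>, \<open>B powr (-\<alpha>)\<close> and \<open>exp (- t A)\<close> have the symbols \<open>r / (1 + t r)\<close>,
  \<open>r powr \<alpha>\<close> (up to a constant factor) and \<open>exp (- t (1 / r - k))\<close> on \<open>{0..c}\<close>. The functional calculus
  \<open>phi\<close> is contractive for the supremum norm, because a polynomial \<open>p\<close> that is nonnegative on
  \<open>{0..c}\<close> has \<open>p(R) \<ge> 0\<close> by Bernstein approximation. All operator estimates are thereby scalar ones.

  Let \<open>u\<close> be a full solution in \<open>K\<close> and \<open>f = g \<circ> u\<close>. The smoothing estimates give a Hoelder bound for
  \<open>B powr \<alpha> (u t)\<close>, hence for \<open>f\<close>, uniformly over \<open>K\<close>. Freezing \<open>f\<close> at time \<open>t\<close> in the variation of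
  constants formula on \<open>{t - \<tau>..t}\<close> shows that \<open>u t\<close> lies in the domain and that \<open>B (u t)\<close> differs from
  \<open>B (exp (- \<tau> A) (u (t - \<tau>))) + f t - exp (- \<tau> A) (f t)\<close> by \<open>O(\<tau> powr \<theta>)\<close>. For fixed \<open>\<tau>\<close> the latter
  points form a subset of a compact set, so \<open>B ` K\<close> is totally bounded; it is closed as the preimage of
  \<open>K\<close> under \<open>R\<close>.
\<close>

text \<open>Working with \<open>R\<close> instead of \<open>B\<close> compactifies the spectrum:
  \<open>r = 0\<close> stands for the point at infinity, and the symbols extend continuously to it.
  Two obstacles shape the estimates. The norm of \<open>B exp (- \<sigma> A)\<close> is only bounded
  by a multiple of \<open>1 / \<sigma>\<close>, which is not integrable at
  \<open>\<sigma> = 0\<close>; the Hoelder bound has to come before the freezing because it improves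
  this singularity to \<open>\<sigma> powr (\<theta> - 1)\<close>. Moreover \<open>B (u t)\<close>
  is not known to exist beforehand, so estimates are made on pairings with vectors to which
  \<open>B\<close> or its fractional power can be moved; density gives back the norms,
  self-adjointness the membership in the domain. Uniformity over \<open>K\<close> rests on solutions
  existing for all negative times: a solution can be restarted at an earlier time from another point
  of \<open>K\<close>, so no singularity at an initial time enters and the constants depend only on
  bounds over \<open>K\<close>.\<close>

section \<open>Two preliminaries: binomial ratios against powers, and norms from dense test
  vectors\<close>

text \<open>Sums over the Bernstein basis reproduce powers exactly when \<open>(k / n) ^ m\<close>
  is replaced by this ratio of binomial coefficients. The ratio is a product of \<open>m\<close>
  factors, each within \<open>m / (n - m)\<close> of \<open>k / n\<close>, so the replacement costs
  \<open>O(1 / n)\<close> uniformly in \<open>k\<close>.\<close>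

lemma power_minus_binomial_ratio_le:
  fixes k n m :: nat
  assumes kn: "k \<le> n" and mn: "2 * m < n"
  shows "\<bar>(real k / real n) ^ m - real (k choose m) / real (n choose m)\<bar>
           \<le> real m * (real m / (real n - real m))"
proof -
  have n0: "real n - real m > 0" "n > 0" using mn by auto
  have c: "real (j choose m) = (\<Prod>i=0..<m. real j - real i) / fact m" for j
    by (simp add: binomial_gbinomial gbinomial_prod_rev)
  have eq: "real (k choose m) / real (n choose m)
      = (\<Prod>i=0..<m. (real k - real i) / (real n - real i))"
    by (simp add: c prod_dividef)
  have pw: "(real k / real n) ^ m = (\<Prod>i=0..<m. real k / real n)" by simp
  have "norm ((\<Prod>i=0..<m. real k / real n) - (\<Prod>i=0..<m. (real k - real i) / (real n - real i)))
      \<le> (\<Sum>i=0..<m. norm (real k / real n - (real k - real i) / (real n - real i)))"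
  proof (rule norm_prod_diff)
    show "norm (real k / real n) \<le> 1" for i using kn n0 by simp
    \<comment> \<open>For \<open>k < i\<close> the factor is negative; \<open>2 * m < n\<close>
      still keeps its absolute value at most 1.\<close>
    show "norm ((real k - real i) / (real n - real i)) \<le> 1" if "i \<in> {0..<m}" for i
      using that kn mn by (auto simp: abs_le_iff divide_le_eq)
  qed
  also have "\<dots> \<le> (\<Sum>i=0..<m. real m / (real n - real m))"
  proof (rule sum_mono)
    fix i assume i: "i \<in> {0..<m}"
    have ni: "real n - real i > 0" using i mn by auto
    have "real k / real n - (real k - real i) / (real n - real i)
        = (real i / (real n - real i)) * ((real n - real k) / real n)"
      using ni n0 by (simp add: field_simps)
    moreover have "0 \<le> (real n - real k) / real n" "(real n - real k) / real n \<le> 1"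
      using kn n0 by (auto simp: field_simps)
    moreover have "0 \<le> real i / (real n - real i)" using ni by simp
    moreover have "real i / (real n - real i) \<le> real m / (real n - real m)"
      using i n0 ni by (intro frac_le) auto
    ultimately show "norm (real k / real n - (real k - real i) / (real n - real i))
        \<le> real m / (real n - real m)"
      using mult_mono[of "real i / (real n - real i)" "real m / (real n - real m)"
          "(real n - real k) / real n" 1] n0 ni by (simp del: times_divide_eq_left times_divide_eq_right)
  qed
  finally show ?thesis unfolding eq pw by simp
qed

text \<open>This turns weak estimates into norm estimates. The one-sided bound passes to the closure
  and is then used at \<open>y = z\<close>.\<close>

lemma norm_le_if_inner_le_dense:
  fixes z :: "'a::real_inner"
  assumes dense: "closure S = UNIV" and "0 \<le> C"
    and bound: "\<And>y. y \<in> S \<Longrightarrow> inner z y \<le> C * norm y"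
  shows "norm z \<le> C"
proof -
  have "closed {y. inner z y \<le> C * norm y}"
    by (intro closed_Collect_le continuous_intros)
  with bound have "closure S \<subseteq> {y. inner z y \<le> C * norm y}"
    by (intro closure_minimal) auto
  then have le: "inner z y \<le> C * norm y" for y using dense by auto
  show ?thesis using le[of z] \<open>0 \<le> C\<close>
    by (cases "z = 0") (simp_all add: dot_square_norm power2_eq_square)
qed

subsection \<open>Polynomials of a positive bounded operator\<close>

locale positive_operator =
  fixes R :: "'a::{real_inner,complete_space} \<Rightarrow> 'a" and c :: real
  assumes linear_R: "linear R"
    and sym_R: "inner (R x) y = inner x (R y)"
    and inner_R_ge_0: "0 \<le> inner (R x) x"
    and inner_R_le: "inner (R x) x \<le> c * inner x x"
    and c_pos: "0 < c"
begin

definition pev :: "real poly \<Rightarrow> 'a \<Rightarrow> 'a" where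
  "pev p x = (\<Sum>i\<le>degree p. coeff p i *\<^sub>R (R ^^ i) x)"

lemma R_simps: "R (x + y) = R x + R y" "R (a *\<^sub>R x) = a *\<^sub>R R x" "R 0 = 0"
    "R (- x) = - R x" "R (x - y) = R x - R y"
  using linear_R by (auto simp: linear_add linear_scale linear_0 linear_neg linear_diff)

lemma pev_0 [simp]: "pev 0 x = 0"
  by (simp add: pev_def)

lemma pev_pCons [simp]: "pev (pCons a p) x = a *\<^sub>R x + R (pev p x)"
proof (cases "p = 0")
  case True
  then show ?thesis by (simp add: pev_def R_simps)
next
  case False
  then show ?thesis
    by (simp add: pev_def sum.atMost_Suc_shift linear_sum[OF linear_R] R_simps del: sum.atMost_Suc)
qed

lemma pev_add: "pev (p + q) x = pev p x + pev q x"
  by (induct p q rule: poly_induct2) (simp_all add: R_simps algebra_simps)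

lemma pev_smult: "pev (smult a p) x = a *\<^sub>R pev p x"
  by (induct p) (simp_all add: R_simps algebra_simps)

lemma pev_diff: "pev (p - q) x = pev p x - pev q x"
  using pev_add[of p "smult (-1) q" x] pev_smult[of "-1" q x] by simp

lemma pev_sum: "pev (sum f I) x = (\<Sum>i\<in>I. pev (f i) x)"
  by (induct I rule: infinite_finite_induct) (simp_all add: pev_add)

lemma pev_mult: "pev (p * q) x = pev p (pev q x)"
  by (induct p) (simp_all add: pev_add pev_smult)

lemma pev_1 [simp]: "pev 1 x = x"
  by (simp add: one_pCons R_simps)

lemma linear_pev: "linear (pev p)"
proof (induct p)
  case 0
  then show ?case by (simp add: linear_iff)
next
  case (pCons a p)
  then show ?case by (simp add: linear_iff R_simps algebra_simps)
qed

lemma sym_pev: "inner (pev p x) y = inner x (pev p y)"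
proof (induct p arbitrary: x y)
  case (pCons a p)
  have "pev p (R y) = R (pev p y)"
    using pev_mult[of p "[:0, 1:]" y] pev_mult[of "[:0, 1:]" p y] by (simp add: R_simps)
  with pCons show ?case by (simp add: inner_add sym_R)
qed simp

text \<open>Positivity of the operator \<open>pev p\<close>, not of the values of \<open>p\<close>;
  the link between the two is the aim of this part.\<close>

definition nonneg_poly :: "real poly \<Rightarrow> bool" where
  "nonneg_poly p \<longleftrightarrow> (\<forall>x. 0 \<le> inner (pev p x) x)"

lemma nonneg_poly_add: "nonneg_poly p \<Longrightarrow> nonneg_poly q \<Longrightarrow> nonneg_poly (p + q)"
  by (simp add: nonneg_poly_def pev_add inner_add)

lemma nonneg_poly_smult: "nonneg_poly p \<Longrightarrow> 0 \<le> a \<Longrightarrow> nonneg_poly (smult a p)"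
  by (simp add: nonneg_poly_def pev_smult)

text \<open>Since \<open>pev q\<close> is symmetric and commutes with \<open>pev p\<close>, one
  factor \<open>q\<close> can be moved to the other side of the inner product.\<close>

lemma nonneg_poly_square_mult: "nonneg_poly p \<Longrightarrow> nonneg_poly (q * (q * p))"
proof -
  assume p: "nonneg_poly p"
  have "inner (pev (q * (q * p)) x) x = inner (pev p (pev q x)) (pev q x)" for x
  proof -
    have "inner (pev (q * (q * p)) x) x = inner (pev q (pev (p * q) x)) x"
      by (simp add: pev_mult[symmetric] ac_simps)
    then show ?thesis by (simp add: sym_pev[of q] pev_mult)
  qed
  then show ?thesis using p by (simp add: nonneg_poly_def)
qed

lemma nonneg_poly_1: "nonneg_poly 1"
  by (simp add: nonneg_poly_def)

text \<open>The affine functions \<open>r / c\<close> and \<open>1 - r / c\<close> are the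
  barycentric coordinates of \<open>r\<close> in \<open>{0..c}\<close>; their products form the
  Bernstein basis of that interval.\<close>

abbreviation X where "X \<equiv> [:0, 1 / c:]"
abbreviation Y where "Y \<equiv> [:1, - 1 / c:]"

lemma X_plus_Y: "X + Y = 1"
  by (simp add: one_pCons)

lemma nonneg_poly_X: "nonneg_poly X"
  using inner_R_ge_0 c_pos by (simp add: nonneg_poly_def R_simps)

lemma nonneg_poly_Y: "nonneg_poly Y"
  using inner_R_le c_pos by (simp add: nonneg_poly_def R_simps inner_diff inner_add field_simps)

text \<open>Multiplying by \<open>X + Y = 1\<close> writes the product as a sum of terms of the form
  square times positive, so no square root of an operator is needed.\<close>

lemma nonneg_poly_XY: "nonneg_poly (X * Y)"
proof -
  have "X * Y = X * Y * (X + Y)" unfolding X_plus_Y by simp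
  also have "\<dots> = X * (X * Y) + Y * (Y * X)" by (simp only: algebra_simps)
  finally have eq: "X * Y = X * (X * Y) + Y * (Y * X)" .
  show ?thesis
    by (rule ssubst[OF eq, of nonneg_poly])
       (intro nonneg_poly_add nonneg_poly_square_mult nonneg_poly_X nonneg_poly_Y)
qed

lemma nonneg_poly_XkYj: "nonneg_poly (X ^ k * Y ^ j)"
proof -
  have "X ^ k * Y ^ j = (X ^ (k div 2) * Y ^ (j div 2)) * ((X ^ (k div 2) * Y ^ (j div 2))
           * (X ^ (k mod 2) * Y ^ (j mod 2)))"
  proof -
    have *: "Z ^ n = Z ^ (n div 2) * Z ^ (n div 2) * Z ^ (n mod 2)" for Z :: "real poly" and n
      by (metis div_mult_mod_eq mult.commute mult_2 power_add)
    show ?thesis by (subst *[of X k], subst *[of Y j]) (simp only: ac_simps)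
  qed
  moreover have "nonneg_poly (X ^ (k mod 2) * Y ^ (j mod 2))"
    using nonneg_poly_X nonneg_poly_Y nonneg_poly_XY nonneg_poly_1
    by (cases "even k"; cases "even j") (simp_all add: even_iff_mod_2_eq_zero odd_iff_mod_2_eq_one)
  ultimately show ?thesis by (simp only: nonneg_poly_square_mult)
qed

definition bern :: "nat \<Rightarrow> nat \<Rightarrow> real poly" where
  "bern n k = smult (real (n choose k)) (X ^ k * Y ^ (n - k))"

text \<open>These are the factorial moments of the binomial distribution. Absorbing
  \<open>k choose m\<close> into \<open>n choose k\<close> leaves the binomial expansion of
  \<open>(X + Y) ^ (n - m)\<close>, which is 1.\<close>

lemma sum_choose_bern:
  assumes "m \<le> n"
  shows "(\<Sum>k\<le>n. smult (real (k choose m)) (bern n k)) = smult (real (n choose m)) (X ^ m)"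
proof -
  have "(\<Sum>k\<le>n. smult (real (k choose m)) (bern n k))
      = (\<Sum>k=m..n. smult (real (k choose m)) (bern n k))"
    by (rule sum.mono_neutral_right) auto
  also have "\<dots> = (\<Sum>k=0 + m..(n - m) + m. smult (real (k choose m)) (bern n k))"
    using assms by simp
  also have "\<dots> = (\<Sum>j=0..n - m. smult (real ((j + m) choose m)) (bern n (j + m)))"
    by (rule sum.shift_bounds_cl_nat_ivl)
  also have "\<dots> = (\<Sum>j=0..n - m. smult (real (n choose m)) (X ^ m
                   * (of_nat ((n - m) choose j) * X ^ j * Y ^ (n - m - j))))"
  proof (rule sum.cong)
    fix j assume j: "j \<in> {0..n - m}"
    have "(n choose (j + m)) * ((j + m) choose m) = (n choose m) * ((n - m) choose j)"
      using j assms choose_mult[of m "j + m" n] by simp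
    then have "real ((j + m) choose m) * real (n choose (j + m)) = real (n choose m) * real ((n - m) choose j)"
      by (metis mult.commute of_nat_mult)
    moreover have "n - (j + m) = n - m - j" by simp
    moreover have "smult a (p * (of_nat b * q * r)) = smult (a * real b) (q * p * r)"
      for a b and p q r :: "real poly"
      by (simp add: of_nat_poly ac_simps)
    ultimately show "smult (real ((j + m) choose m)) (bern n (j + m)) = smult (real (n choose m)) (X ^ m
                   * (of_nat ((n - m) choose j) * X ^ j * Y ^ (n - m - j)))"
      unfolding bern_def by (simp only: power_add smult_smult)
  qed simp
  also have "\<dots> = smult (real (n choose m)) (X ^ m * (X + Y) ^ (n - m))"
  proof -
    have sm: "(\<Sum>i\<in>I. smult a (f i)) = smult a (sum f I)" for a and f :: "nat \<Rightarrow> real poly" and I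
      by (induct I rule: infinite_finite_induct) (simp_all add: smult_add_right)
    show ?thesis unfolding binomial_ring sum_distrib_left atMost_atLeast0 by (rule sm)
  qed
  finally show ?thesis by (simp only: X_plus_Y) simp
qed


text \<open>For fixed \<open>x\<close> the numbers \<open>\<beta> k\<close> below are nonnegative
  weights of total mass \<open>inner x x\<close>. The quadratic form becomes a weighted sum of the
  values at \<open>k / n\<close>, with powers replaced by binomial ratios. The values are
  nonnegative, the replacement costs at most \<open>\<epsilon> n\<close>, and \<open>n\<close> tends
  to infinity.\<close>

lemma inner_pev_ge_0_scaled:
  assumes nn: "\<And>s. 0 \<le> s \<Longrightarrow> s \<le> 1 \<Longrightarrow> 0 \<le> (\<Sum>m\<le>d. a m * s ^ m)"
  shows "0 \<le> inner (pev (\<Sum>m\<le>d. smult (a m) (X ^ m)) x) x"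
proof -
  define \<epsilon> where "\<epsilon> n = (\<Sum>m\<le>d. \<bar>a m\<bar> * (real m * (real m / (real n - real m))))" for n :: nat
  have bnd: "- (\<epsilon> n * inner x x) \<le> inner (pev (\<Sum>m\<le>d. smult (a m) (X ^ m)) x) x" if n: "2 * d < n" for n
  proof -
    define \<beta> where "\<beta> k = inner (pev (bern n k) x) x" for k
    have \<beta>0: "0 \<le> \<beta> k" for k
      unfolding \<beta>_def bern_def using nonneg_poly_smult[OF nonneg_poly_XkYj]
      by (auto simp: nonneg_poly_def)
    have sum_\<beta>: "real (n choose m) * inner (pev (X ^ m) x) x = (\<Sum>k\<le>n. real (k choose m) * \<beta> k)"
      if "m \<le> n" for m
      using arg_cong[OF sum_choose_bern[OF that], of "\<lambda>p. inner (pev p x) x"]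
      by (simp only: pev_sum pev_smult inner_sum_left inner_scaleR_left \<beta>_def)
    define \<xi> where "\<xi> m = inner (pev (X ^ m) x) x" for m
    have \<beta>1: "(\<Sum>k\<le>n. \<beta> k) = inner x x"
      using sum_\<beta>[of 0] by simp
    have \<xi>: "\<xi> m = (\<Sum>k\<le>n. real (k choose m) / real (n choose m) * \<beta> k)" if "m \<le> d" for m
    proof -
      have "real (n choose m) * \<xi> m = (\<Sum>k\<le>n. real (k choose m) * \<beta> k)"
        unfolding \<xi>_def using sum_\<beta>[of m] that n by linarith
      moreover have "real (n choose m) \<noteq> 0" using that n by simp
      moreover have "(\<Sum>k\<le>n. real (k choose m) / real (n choose m) * \<beta> k)
          = (\<Sum>k\<le>n. real (k choose m) * \<beta> k) / real (n choose m)"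
        by (simp add: sum_divide_distrib)
      ultimately show ?thesis by (metis nonzero_mult_div_cancel_left)
    qed
    have "inner (pev (\<Sum>m\<le>d. smult (a m) (X ^ m)) x) x = (\<Sum>m\<le>d. a m * \<xi> m)"
      by (simp only: pev_sum pev_smult inner_sum_left inner_scaleR_left \<xi>_def)
    also have "\<dots> = (\<Sum>m\<le>d. a m * (\<Sum>k\<le>n. real (k choose m) / real (n choose m) * \<beta> k))"
      by (simp add: \<xi>)
    also have "\<dots> = (\<Sum>k\<le>n. (\<Sum>m\<le>d. a m * (real (k choose m) / real (n choose m))) * \<beta> k)"
      unfolding sum_distrib_left sum_distrib_right by (subst sum.swap) (simp add: ac_simps)
    also have "\<dots> \<ge> (\<Sum>k\<le>n. - \<epsilon> n * \<beta> k)"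
    proof (intro sum_mono mult_right_mono \<beta>0)
      fix k assume k: "k \<in> {..n}"
      have "\<bar>(\<Sum>m\<le>d. a m * (real k / real n) ^ m) - (\<Sum>m\<le>d. a m * (real (k choose m) / real (n choose m)))\<bar>
          = \<bar>\<Sum>m\<le>d. a m * ((real k / real n) ^ m - real (k choose m) / real (n choose m))\<bar>"
        by (simp add: sum_subtractf algebra_simps)
      also have "\<dots> \<le> (\<Sum>m\<le>d. \<bar>a m * ((real k / real n) ^ m - real (k choose m) / real (n choose m))\<bar>)"
        by (rule sum_abs)
      also have "\<dots> \<le> \<epsilon> n"
        unfolding \<epsilon>_def abs_mult
        by (intro sum_mono mult_left_mono power_minus_binomial_ratio_le) (use k n in auto)
      finally show "- \<epsilon> n \<le> (\<Sum>m\<le>d. a m * (real (k choose m) / real (n choose m)))"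
        using nn[of "real k / real n"] k n by (simp add: abs_le_iff)
    qed
    finally have "(\<Sum>k\<le>n. - \<epsilon> n * \<beta> k) \<le> inner (pev (\<Sum>m\<le>d. smult (a m) (X ^ m)) x) x" .
    moreover have "(\<Sum>k\<le>n. - \<epsilon> n * \<beta> k) = - (\<epsilon> n * inner x x)"
      unfolding \<beta>1[symmetric] by (simp add: sum_distrib_left sum_negf)
    ultimately show ?thesis by (simp only:)
  qed
  have "(\<lambda>n. \<bar>a m\<bar> * (real m * (real m / (real n - real m)))) \<longlonglongrightarrow> 0" for m
  proof -
    have "filterlim (\<lambda>n. - real m + real n) at_top sequentially"
      by (rule filterlim_tendsto_add_at_top[OF tendsto_const filterlim_real_sequentially])
    then have "filterlim (\<lambda>n. real n - real m) at_infinity sequentially"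
      by (intro filterlim_at_top_imp_at_infinity) (simp add: algebra_simps)
    then show ?thesis
      by (intro tendsto_mult_right_zero tendsto_divide_0[OF tendsto_const])
  qed
  then have "\<epsilon> \<longlonglongrightarrow> (\<Sum>m\<le>d. 0)"
    unfolding \<epsilon>_def by (intro tendsto_sum)
  then have lim: "(\<lambda>n. - (\<epsilon> n * inner x x)) \<longlonglongrightarrow> - (0 * inner x x)"
    by (intro tendsto_intros) simp
  have "\<forall>\<^sub>F n in sequentially. - (\<epsilon> n * inner x x) \<le> inner (pev (\<Sum>m\<le>d. smult (a m) (X ^ m)) x) x"
    using eventually_gt_at_top[of "2 * d"] by eventually_elim (rule bnd)
  from tendsto_upperbound[OF lim this sequentially_bot] show ?thesis
    by (simp only: mult_zero_left minus_zero)
qed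

lemma inner_pev_ge_0:
  assumes "\<And>r. 0 \<le> r \<Longrightarrow> r \<le> c \<Longrightarrow> 0 \<le> poly p r"
  shows "0 \<le> inner (pev p x) x"
proof -
  define a where "a m = coeff p m * c ^ m" for m
  have "X ^ m = smult ((1 / c) ^ m) (monom 1 m)" for m
  proof -
    have "X = smult (1 / c) (monom 1 1)" by (simp add: monom_altdef)
    then show ?thesis by (simp only: smult_power monom_power) simp
  qed
  then have "(\<Sum>m\<le>degree p. smult (a m) (X ^ m)) = (\<Sum>m\<le>degree p. monom (coeff p m) m)"
    using c_pos by (simp add: a_def smult_monom power_divide)
  also have "\<dots> = p" by (rule poly_as_sum_of_monoms)
  finally have p: "(\<Sum>m\<le>degree p. smult (a m) (X ^ m)) = p" .
  have "0 \<le> (\<Sum>m\<le>degree p. a m * s ^ m)" if "0 \<le> s" "s \<le> 1" for s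
    using assms[of "c * s"] that c_pos mult_left_le[of s c]
    by (simp add: poly_altdef a_def power_mult_distrib ac_simps)
  from inner_pev_ge_0_scaled[OF this] show ?thesis unfolding p .
qed

text \<open>Positivity is applied to \<open>M ^ 2 - p ^ 2\<close>, whose form at \<open>x\<close> is
  the difference of the two squared norms.\<close>

lemma norm_pev_le:
  assumes "\<And>r. 0 \<le> r \<Longrightarrow> r \<le> c \<Longrightarrow> \<bar>poly p r\<bar> \<le> M"
  shows "norm (pev p x) \<le> M * norm x"
proof -
  have M: "0 \<le> M" using assms[of 0] c_pos by auto
  have "0 \<le> inner (pev ([:M\<^sup>2:] - p * p) x) x"
  proof (rule inner_pev_ge_0)
    fix r assume "0 \<le> r" "r \<le> c"
    then have "\<bar>poly p r\<bar> \<le> \<bar>M\<bar>" using assms M by auto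
    then have "(poly p r)\<^sup>2 \<le> M\<^sup>2" by (simp only: abs_le_square_iff)
    moreover have "poly ([:M\<^sup>2:] - p * p) r = M\<^sup>2 - (poly p r)\<^sup>2"
      by (simp add: power2_eq_square)
    ultimately show "0 \<le> poly ([:M\<^sup>2:] - p * p) r" by linarith
  qed
  moreover have "inner (pev (p * p) x) x = (norm (pev p x))\<^sup>2"
    unfolding pev_mult by (subst sym_pev) (simp add: dot_square_norm)
  moreover have "inner (pev [:M\<^sup>2:] x) x = (M * norm x)\<^sup>2"
    by (simp add: power_mult_distrib dot_square_norm R_simps)
  ultimately have "(norm (pev p x))\<^sup>2 \<le> (M * norm x)\<^sup>2"
    by (simp only: pev_diff inner_diff_left)
  then show ?thesis by (rule power2_le_imp_le) (simp add: M)
qed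

end

lemma eq_if_norm_diff_small:
  fixes a b :: "'a::real_normed_vector"
  assumes "\<And>e::real. 0 < e \<Longrightarrow> e \<le> 1 \<Longrightarrow> norm (a - b) \<le> e * K"
  shows "a = b"
proof -
  have "(\<lambda>n. inverse (real (Suc n)) * K) \<longlonglongrightarrow> 0 * K"
    by (intro tendsto_mult tendsto_const LIMSEQ_inverse_real_of_nat)
  then have "norm (a - b) \<le> 0 * K"
    by (rule LIMSEQ_le_const) (use assms in \<open>auto simp: inverse_le_1_iff\<close>)
  then show ?thesis by simp
qed

context positive_operator
begin

subsection \<open>The continuous functional calculus\<close>

text \<open>The choice depends on \<open>f\<close> only through its values on \<open>{0..c}\<close>;
  this makes \<open>phi_cong\<close> hold for arbitrary functions.\<close>

definition pol :: "(real \<Rightarrow> real) \<Rightarrow> nat \<Rightarrow> real poly" where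
  "pol f n = (SOME p. \<forall>r\<in>{0..c}. \<bar>poly p r - f r\<bar> \<le> inverse (real (Suc n)))"

definition phi :: "(real \<Rightarrow> real) \<Rightarrow> 'a \<Rightarrow> 'a" where
  "phi f x = lim (\<lambda>n. pev (pol f n) x)"

lemma ex_poly_approx:
  assumes "continuous_on {0..c} f" "0 < e"
  obtains p where "\<And>r. r \<in> {0..c} \<Longrightarrow> \<bar>poly p r - f r\<bar> \<le> e"
proof -
  obtain g where g: "real_polynomial_function g" "\<And>r. r \<in> {0..c} \<Longrightarrow> \<bar>f r - g r\<bar> < e"
    using Stone_Weierstrass_real_polynomial_function[OF compact_Icc assms] by blast
  then obtain a n where "g = (\<lambda>x. \<Sum>i\<le>n. a i * x ^ i)"
    by (auto simp: real_polynomial_function_iff_sum)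
  then have "g = poly (\<Sum>i\<le>n. monom (a i) i)"
    by (auto simp: poly_sum poly_monom)
  with g(2) show thesis by (intro that[of "\<Sum>i\<le>n. monom (a i) i"]) (force simp: abs_minus_commute)
qed

lemma pol_approx:
  assumes "continuous_on {0..c} f" "r \<in> {0..c}"
  shows "\<bar>poly (pol f n) r - f r\<bar> \<le> inverse (real (Suc n))"
proof -
  have "\<exists>p. \<forall>r\<in>{0..c}. \<bar>poly p r - f r\<bar> \<le> inverse (real (Suc n))"
    using ex_poly_approx[OF assms(1), of "inverse (real (Suc n))"]
    by (metis inverse_positive_iff_positive of_nat_0_less_iff zero_less_Suc)
  from someI_ex[OF this] show ?thesis
    using assms(2) by (simp add: pol_def)
qed

lemma norm_pev_diff_le:
  assumes "\<And>r. r \<in> {0..c} \<Longrightarrow> \<bar>poly p r - poly q r\<bar> \<le> M"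
  shows "norm (pev p x - pev q x) \<le> M * norm x"
  using norm_pev_le[of "p - q" M x] assms by (simp add: pev_diff)

lemma phi_tendsto:
  assumes f: "continuous_on {0..c} f"
  shows "(\<lambda>n. pev (pol f n) x) \<longlonglongrightarrow> phi f x"
proof -
  have "Cauchy (\<lambda>n. pev (pol f n) x)"
  proof (rule CauchyI)
    fix e :: real assume e: "0 < e"
    have "(\<lambda>n. (2 * norm x) * inverse (real (Suc n))) \<longlonglongrightarrow> (2 * norm x) * 0"
      by (intro tendsto_intros LIMSEQ_inverse_real_of_nat)
    then have "eventually (\<lambda>n. (2 * norm x) * inverse (real (Suc n)) < e) sequentially"
      using e by (intro order_tendstoD) auto
    then obtain N where N: "(2 * norm x) * inverse (real (Suc N)) < e"
      by (auto simp: eventually_sequentially)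
    show "\<exists>M. \<forall>m\<ge>M. \<forall>n\<ge>M. norm (pev (pol f m) x - pev (pol f n) x) < e"
    proof (intro exI allI impI)
      fix m n assume mn: "N \<le> m" "N \<le> n"
      have "norm (pev (pol f m) x - pev (pol f n) x) \<le> (2 * inverse (real (Suc N))) * norm x"
      proof (rule norm_pev_diff_le)
        fix r assume r: "r \<in> {0..c}"
        have "inverse (real (Suc m)) \<le> inverse (real (Suc N))" "inverse (real (Suc n)) \<le> inverse (real (Suc N))"
          using mn by (auto intro!: le_imp_inverse_le)
        with pol_approx[OF f r, of m] pol_approx[OF f r, of n]
        show "\<bar>poly (pol f m) r - poly (pol f n) r\<bar> \<le> 2 * inverse (real (Suc N))"
          unfolding abs_le_iff by linarith
      qed
      then show "norm (pev (pol f m) x - pev (pol f n) x) < e" using N by (simp add: ac_simps)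
    qed
  qed
  then show ?thesis
    unfolding phi_def by (simp add: Cauchy_convergent_iff convergent_LIMSEQ_iff)
qed

text \<open>Any polynomial near \<open>f\<close> will do, not only the chosen
  \<open>pol f n\<close>. The algebraic laws need this, because sums and products of chosen
  approximants are not themselves the chosen ones.\<close>

lemma phi_approx:
  assumes f: "continuous_on {0..c} f" and p: "\<And>r. r \<in> {0..c} \<Longrightarrow> \<bar>poly p r - f r\<bar> \<le> e"
  shows "norm (pev p x - phi f x) \<le> e * norm x"
proof (rule LIMSEQ_le)
  show "(\<lambda>n. norm (pev p x - pev (pol f n) x)) \<longlonglongrightarrow> norm (pev p x - phi f x)"
    by (intro tendsto_intros phi_tendsto f)
  have "(\<lambda>n. (e + inverse (real (Suc n))) * norm x) \<longlonglongrightarrow> (e + 0) * norm x"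
    by (intro tendsto_intros LIMSEQ_inverse_real_of_nat)
  then show "(\<lambda>n. (e + inverse (real (Suc n))) * norm x) \<longlonglongrightarrow> e * norm x" by simp
  show "\<exists>N. \<forall>n\<ge>N. norm (pev p x - pev (pol f n) x) \<le> (e + inverse (real (Suc n))) * norm x"
  proof (intro exI allI impI norm_pev_diff_le)
    fix n r assume r: "r \<in> {0..c}"
    show "\<bar>poly p r - poly (pol f n) r\<bar> \<le> e + inverse (real (Suc n))"
      using p[OF r] pol_approx[OF f r, of n] unfolding abs_le_iff by linarith
  qed
qed

lemma phi_cong:
  assumes "\<And>r. r \<in> {0..c} \<Longrightarrow> f r = g r"
  shows "phi f x = phi g x"
proof -
  have "pol f n = pol g n" for n
    unfolding pol_def using assms by (intro arg_cong[where f = Eps] ext) auto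
  then show ?thesis by (simp add: phi_def)
qed

lemma phi_poly: "phi (poly p) x = pev p x"
proof -
  have "norm (pev p x - phi (poly p) x) \<le> 0 * norm x"
    by (rule phi_approx) (auto intro: continuous_intros)
  then show ?thesis by simp
qed

lemma phi_1: "phi (\<lambda>r. 1) x = x"
  using phi_poly[of 1 x] phi_cong[of "\<lambda>r. 1" "poly 1"] by simp

lemma phi_id: "phi (\<lambda>r. r) x = R x"
  using phi_poly[of "[:0, 1:]" x] phi_cong[of "\<lambda>r. r" "poly [:0, 1:]"] by (simp add: R_simps)

lemma norm_phi_le:
  assumes f: "continuous_on {0..c} f" and M: "\<And>r. r \<in> {0..c} \<Longrightarrow> \<bar>f r\<bar> \<le> M"
  shows "norm (phi f x) \<le> M * norm x"
  using phi_approx[of f 0 M x] assms by simp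

lemma linear_phi:
  assumes f: "continuous_on {0..c} f"
  shows "linear (phi f)"
proof
  fix x y :: 'a and a :: real
  have "(\<lambda>n. pev (pol f n) x + pev (pol f n) y) \<longlonglongrightarrow> phi f (x + y)"
    using phi_tendsto[OF f, of "x + y"] by (simp add: linear_add[OF linear_pev])
  moreover have "(\<lambda>n. pev (pol f n) x + pev (pol f n) y) \<longlonglongrightarrow> phi f x + phi f y"
    by (intro tendsto_intros phi_tendsto f)
  ultimately show "phi f (x + y) = phi f x + phi f y" by (rule LIMSEQ_unique)
  have "(\<lambda>n. a *\<^sub>R pev (pol f n) x) \<longlonglongrightarrow> phi f (a *\<^sub>R x)"
    using phi_tendsto[OF f, of "a *\<^sub>R x"] by (simp add: linear_scale[OF linear_pev])
  moreover have "(\<lambda>n. a *\<^sub>R pev (pol f n) x) \<longlonglongrightarrow> a *\<^sub>R phi f x"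
    by (intro tendsto_intros phi_tendsto f)
  ultimately show "phi f (a *\<^sub>R x) = a *\<^sub>R phi f x" by (rule LIMSEQ_unique)
qed

lemma phi_bound:
  fixes f :: "real \<Rightarrow> real"
  assumes "continuous_on {0..c} f"
  obtains M where "0 \<le> M" "\<And>r. r \<in> {0..c} \<Longrightarrow> \<bar>f r\<bar> \<le> M"
proof -
  have "bounded (f ` {0..c})"
    by (intro compact_imp_bounded compact_continuous_image assms compact_Icc)
  then obtain M where "\<forall>r\<in>{0..c}. \<bar>f r\<bar> \<le> M"
    unfolding bounded_iff real_norm_def by blast
  then show thesis using that[of "\<bar>M\<bar>"] by force
qed

lemma bounded_linear_phi:
  assumes f: "continuous_on {0..c} f"
  shows "bounded_linear (phi f)"
proof -
  obtain M where "\<And>r. r \<in> {0..c} \<Longrightarrow> \<bar>f r\<bar> \<le> M" using phi_bound[OF f] by blast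
  then show ?thesis
    using linear_phi[OF f] norm_phi_le[OF f, of M]
    by (auto simp: bounded_linear_def bounded_linear_axioms_def mult.commute)
qed

lemma sym_phi:
  assumes f: "continuous_on {0..c} f"
  shows "inner (phi f x) y = inner x (phi f y)"
proof (rule LIMSEQ_unique)
  show "(\<lambda>n. inner (pev (pol f n) x) y) \<longlonglongrightarrow> inner (phi f x) y"
    by (intro tendsto_intros phi_tendsto f)
  show "(\<lambda>n. inner (pev (pol f n) x) y) \<longlonglongrightarrow> inner x (phi f y)"
    unfolding sym_pev by (intro tendsto_intros phi_tendsto f)
qed

lemma phi_add:
  assumes f: "continuous_on {0..c} f" and g: "continuous_on {0..c} g"
  shows "phi (\<lambda>r. f r + g r) x = phi f x + phi g x"
proof (rule eq_if_norm_diff_small)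
  fix e :: real assume e: "0 < e"
  obtain p where p: "\<And>r. r \<in> {0..c} \<Longrightarrow> \<bar>poly p r - f r\<bar> \<le> e" using ex_poly_approx[OF f e] by blast
  obtain q where q: "\<And>r. r \<in> {0..c} \<Longrightarrow> \<bar>poly q r - g r\<bar> \<le> e" using ex_poly_approx[OF g e] by blast
  have "norm (pev (p + q) x - phi (\<lambda>r. f r + g r) x) \<le> (2 * e) * norm x"
  proof (rule phi_approx)
    show "\<bar>poly (p + q) r - (f r + g r)\<bar> \<le> 2 * e" if "r \<in> {0..c}" for r
      using p[OF that] q[OF that] by (simp add: abs_le_iff)
  qed (intro continuous_intros f g)
  moreover have "norm (pev p x - phi f x) \<le> e * norm x" "norm (pev q x - phi g x) \<le> e * norm x"
    using phi_approx f g p q by auto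
  moreover have "phi (\<lambda>r. f r + g r) x - (phi f x + phi g x)
      = (pev p x - phi f x) + (pev q x - phi g x) - (pev (p + q) x - phi (\<lambda>r. f r + g r) x)"
    by (simp add: pev_add)
  ultimately show "norm (phi (\<lambda>r. f r + g r) x - (phi f x + phi g x)) \<le> e * (4 * norm x)"
    using norm_triangle_ineq4[of "(pev p x - phi f x) + (pev q x - phi g x)" "pev (p + q) x - phi (\<lambda>r. f r + g r) x"]
      norm_triangle_ineq[of "pev p x - phi f x" "pev q x - phi g x"] by (simp add: algebra_simps)
qed

lemma phi_mult:
  assumes f: "continuous_on {0..c} f" and g: "continuous_on {0..c} g"
  shows "phi (\<lambda>r. f r * g r) x = phi f (phi g x)"
proof -
  obtain M where M: "0 \<le> M" "\<And>r. r \<in> {0..c} \<Longrightarrow> \<bar>f r\<bar> \<le> M" using phi_bound[OF f] by blast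
  obtain N where N: "0 \<le> N" "\<And>r. r \<in> {0..c} \<Longrightarrow> \<bar>g r\<bar> \<le> N" using phi_bound[OF g] by blast
  show ?thesis
  proof (rule eq_if_norm_diff_small)
    fix e :: real assume e: "0 < e" "e \<le> 1"
    obtain p where p: "\<And>r. r \<in> {0..c} \<Longrightarrow> \<bar>poly p r - f r\<bar> \<le> e" using ex_poly_approx[OF f e(1)] by blast
    obtain q where q: "\<And>r. r \<in> {0..c} \<Longrightarrow> \<bar>poly q r - g r\<bar> \<le> e" using ex_poly_approx[OF g e(1)] by blast
    have pM: "\<bar>poly p r\<bar> \<le> M + 1" if "r \<in> {0..c}" for r
      using p[OF that] M(2)[OF that] e by (simp add: abs_le_iff)
    have 1: "norm (pev (p * q) x - phi (\<lambda>r. f r * g r) x) \<le> (e * (M + 1 + N)) * norm x"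
    proof (rule phi_approx)
      fix r assume r: "r \<in> {0..c}"
      have "poly (p * q) r - f r * g r = poly p r * (poly q r - g r) + (poly p r - f r) * g r"
        by (simp add: algebra_simps)
      also have "\<bar>\<dots>\<bar> \<le> (M + 1) * e + e * N"
        using pM[OF r] p[OF r] q[OF r] N(2)[OF r] M(1) N(1) e
        by (intro order_trans[OF abs_triangle_ineq] add_mono) (auto simp: abs_mult intro!: mult_mono)
      finally show "\<bar>poly (p * q) r - f r * g r\<bar> \<le> e * (M + 1 + N)" by (simp add: algebra_simps)
    qed (intro continuous_intros f g)
    have 2: "norm (pev p (pev q x - phi g x)) \<le> (M + 1) * (e * norm x)"
      using norm_pev_le[of p "M + 1"] pM phi_approx[OF g q] M(1)
      by (meson atLeastAtMost_iff mult_left_mono order_trans add_nonneg_nonneg zero_le_one)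
    have 3: "norm (pev p (phi g x) - phi f (phi g x)) \<le> e * (N * norm x)"
      using phi_approx[OF f p] norm_phi_le[OF g N(2)] e
      by (meson mult_left_mono order_trans less_imp_le)
    have "phi (\<lambda>r. f r * g r) x - phi f (phi g x)
        = pev p (pev q x - phi g x) + (pev p (phi g x) - phi f (phi g x)) - (pev (p * q) x - phi (\<lambda>r. f r * g r) x)"
      by (simp add: pev_mult linear_diff[OF linear_pev])
    also have "norm \<dots> \<le> (M + 1) * (e * norm x) + e * (N * norm x) + (e * (M + 1 + N)) * norm x"
      by (intro order_trans[OF norm_triangle_ineq4] add_mono order_trans[OF norm_triangle_ineq] 1 2 3)
    also have "\<dots> = e * ((2 * M + 2 + 2 * N) * norm x)" by (simp add: algebra_simps)
    finally show "norm (phi (\<lambda>r. f r * g r) x - phi f (phi g x)) \<le> e * ((2 * M + 2 + 2 * N) * norm x)" .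
  qed
qed

lemma phi_scale:
  assumes f: "continuous_on {0..c} f"
  shows "phi (\<lambda>r. a * f r) x = a *\<^sub>R phi f x"
proof -
  have "phi (\<lambda>r. a) y = a *\<^sub>R y" for y
    using phi_poly[of "[:a:]" y] phi_cong[of "\<lambda>r. a" "poly [:a:]"] by (simp add: R_simps)
  with phi_mult[OF continuous_on_const f, of a x] show ?thesis by simp
qed

lemma phi_diff:
  assumes f: "continuous_on {0..c} f" and g: "continuous_on {0..c} g"
  shows "phi (\<lambda>r. f r - g r) x = phi f x - phi g x"
  using phi_add[OF f continuous_on_mult_left[OF g, of "-1"], of x] phi_scale[OF g, of "-1" x] by simp

lemma phi_power:
  assumes f: "continuous_on {0..c} f"
  shows "phi (\<lambda>r. f r ^ n) x = (phi f ^^ n) x"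
proof (induct n)
  case (Suc n)
  then show ?case using phi_mult[OF f continuous_on_power[OF f, of n], of x] by simp
qed (simp add: phi_1)

text \<open>Contractivity of \<open>phi\<close> reduces the claim to a difference quotient that
  converges uniformly in \<open>r\<close>. That follows from the mean value theorem for
  \<open>G v r - v * H t r\<close> in \<open>v\<close>, whose derivative is small by uniform
  continuity of \<open>H\<close> on the compact rectangle.\<close>

lemma phi_has_vector_derivative:
  assumes cont: "continuous_on ({a..b} \<times> {0..c}) (\<lambda>(t, r). H t r)"
    and contG: "\<And>t. t \<in> {a..b} \<Longrightarrow> continuous_on {0..c} (G t)"
    and der: "\<And>t r. t \<in> {a..b} \<Longrightarrow> r \<in> {0..c} \<Longrightarrow> ((\<lambda>t. G t r) has_real_derivative H t r) (at t)"
    and t: "t \<in> {a<..<b}"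
  shows "((\<lambda>t. phi (G t) x) has_vector_derivative phi (H t) x) (at t)"
proof -
  have contH: "continuous_on {0..c} (H s)" if "s \<in> {a..b}" for s
  proof -
    have "continuous_on {0..c} (Pair s)" by (intro continuous_on_Pair continuous_on_id continuous_on_const)
    moreover have "Pair s ` {0..c} \<subseteq> {a..b} \<times> {0..c}" using that by auto
    ultimately show ?thesis
      using continuous_on_compose2[OF cont, of "{0..c}" "Pair s"] by simp
  qed
  have uc: "uniformly_continuous_on ({a..b} \<times> {0..c}) (\<lambda>(t, r). H t r)"
    by (intro compact_uniformly_continuous cont compact_Times compact_Icc)
  have "\<exists>d>0. \<forall>s. norm (s - t) < d \<longrightarrow>
      norm (phi (G s) x - phi (G t) x - (s - t) *\<^sub>R phi (H t) x) \<le> e * norm (s - t)" if e: "0 < e" for e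
  proof -
    define e' where "e' = e / (norm x + 1)"
    have e': "0 < e'" using e by (simp add: e'_def add_nonneg_pos)
    obtain d where d: "0 < d" "\<And>s r. s \<in> {a..b} \<Longrightarrow> r \<in> {0..c} \<Longrightarrow> dist s t < d \<Longrightarrow> \<bar>H s r - H t r\<bar> < e'"
    proof -
      obtain d where d: "0 < d" "\<And>y z. y \<in> {a..b} \<times> {0..c} \<Longrightarrow> z \<in> {a..b} \<times> {0..c} \<Longrightarrow> dist z y < d
           \<Longrightarrow> dist (case z of (t, r) \<Rightarrow> H t r) (case y of (t, r) \<Rightarrow> H t r) < e'"
        using uc e' unfolding uniformly_continuous_on_def by metis
      show thesis
      proof (rule that[OF d(1)])
        fix s r assume "s \<in> {a..b}" "r \<in> {0..c}" "dist s t < d"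
        then show "\<bar>H s r - H t r\<bar> < e'"
          using d(2)[of "(t, r)" "(s, r)"] t by (simp add: dist_Pair_Pair dist_real_def)
      qed
    qed
    define d' where "d' = min d (min (t - a) (b - t))"
    have d': "0 < d'" using d(1) t by (auto simp: d'_def)
    show ?thesis
    proof (intro exI conjI allI impI)
      fix s assume s: "norm (s - t) < d'"
      then have sab: "s \<in> {a..b}" and tab: "t \<in> {a..b}" using t by (auto simp: d'_def)
      have "\<bar>G s r - G t r - (s - t) * H t r\<bar> \<le> e' * \<bar>s - t\<bar>" if r: "r \<in> {0..c}" for r
      proof -
        define F where "F v = G v r - v * H t r" for v
        have "norm (F s - F t) \<le> e' * norm (s - t)"
        proof (rule field_differentiable_bound[where S = "{min s t..max s t}" and f = F and f' = "\<lambda>u. H u r - H t r"])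
          fix u assume u: "u \<in> {min s t..max s t}"
          then have uab: "u \<in> {a..b}" using sab tab by auto
          show "(F has_field_derivative H u r - H t r) (at u within {min s t..max s t})"
            unfolding F_def by (rule DERIV_subset[of _ _ _ UNIV]) (auto intro!: derivative_eq_intros der[OF uab r])
          have "dist u t < d" using u s by (auto simp: d'_def dist_real_def min_def max_def split: if_splits)
          then show "norm (H u r - H t r) \<le> e'"
            using d(2)[OF uab r] by (simp add: less_imp_le)
        qed auto
        then show ?thesis by (simp add: F_def algebra_simps)
      qed
      then have "norm (phi (\<lambda>r. G s r - G t r - (s - t) * H t r) x) \<le> (e' * \<bar>s - t\<bar>) * norm x"
        by (intro norm_phi_le continuous_intros contG contH sab tab)
      also have "phi (\<lambda>r. G s r - G t r - (s - t) * H t r) x = phi (G s) x - phi (G t) x - (s - t) *\<^sub>R phi (H t) x"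
        by (subst phi_diff phi_scale, (intro continuous_intros contG contH sab tab)+)+ (rule refl)
      also have "(e' * \<bar>s - t\<bar>) * norm x \<le> e * norm (s - t)"
      proof -
        have "e' * norm x \<le> e" using e norm_ge_zero[of x] by (simp add: e'_def divide_le_eq algebra_simps not_less)
        from mult_right_mono[OF this, of "\<bar>s - t\<bar>"] show ?thesis by (simp add: ac_simps)
      qed
      finally show "norm (phi (G s) x - phi (G t) x - (s - t) *\<^sub>R phi (H t) x) \<le> e * norm (s - t)" .
    qed (rule d')
  qed
  then show ?thesis
    unfolding has_vector_derivative_def has_derivative_at_alt
    by (auto simp: bounded_linear_scaleR_left)
qed

end

section \<open>Scalar estimates behind the exponential formula and Balakrishnan's formula\<close>

text \<open>The bound must be uniform in all \<open>x \<ge> - a\<close>, because \<open>x\<close>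
  will be \<open>t * (1 / r - k)\<close>, which is unbounded above as \<open>r\<close> tends to 0.
  The inequality \<open>1 + y \<le> exp y\<close> gives the lower estimate, and the same inequality
  at \<open>- y / (1 + y)\<close> gives the upper one.\<close>

lemma abs_inverse_power_minus_exp_le:
  fixes a x :: real and n :: nat
  assumes a: "0 \<le> a" and x: "- a \<le> x" and n: "0 < n" "2 * a \<le> real n"
  shows "\<bar>(1 / (1 + x / real n)) ^ n - exp (- x)\<bar> \<le> (8 + 2 * a\<^sup>2 * exp (2 * a)) / real n"
proof -
  define y where "y = x / real n"
  have xy: "x = real n * y" using n by (simp add: y_def)
  have "- (1 / 2) \<le> y" using x n by (simp add: y_def field_simps)
  then have y1: "1 / 2 \<le> 1 + y" by simp
  then have y0: "0 < 1 + y" by linarith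
  have "(1 + y) ^ n \<le> exp y ^ n"
    using y0 by (intro power_mono exp_ge_add_one_self) auto
  then have "(1 + y) ^ n \<le> exp x" by (simp add: xy exp_of_nat_mult)
  then have lower: "exp (- x) \<le> (1 / (1 + y)) ^ n"
    using y0 by (simp add: exp_minus power_one_over divide_simps)
  have "1 / (1 + y) = 1 + (- y / (1 + y))" using y0 by (simp add: field_simps)
  also have "\<dots> \<le> exp (- y / (1 + y))" by (rule exp_ge_add_one_self)
  finally have "(1 / (1 + y)) ^ n \<le> exp (- y / (1 + y)) ^ n"
    using y0 by (intro power_mono) auto
  then have upper: "(1 / (1 + y)) ^ n \<le> exp (- (x / (1 + y)))"
    by (simp add: xy exp_of_nat_mult[symmetric])
  have nx: "real n / 2 \<le> real n + x" using x n by simp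
  then have nx0: "0 < real n + x" using n by simp
  have "x - x / (1 + y) = x\<^sup>2 / (real n + x)"
    using y0 nx0 n by (simp add: y_def field_simps power2_eq_square)
  then have "exp (- x) = exp (- (x / (1 + y))) * exp (- (x\<^sup>2 / (real n + x)))"
    by (simp add: exp_add[symmetric])
  moreover have "1 - x\<^sup>2 / (real n + x) \<le> exp (- (x\<^sup>2 / (real n + x)))"
    using exp_ge_add_one_self[of "- (x\<^sup>2 / (real n + x))"] by simp
  ultimately have diff: "exp (- (x / (1 + y))) - exp (- x) \<le> exp (- (x / (1 + y))) * (x\<^sup>2 / (real n + x))"
    using mult_left_mono[of "1 - x\<^sup>2 / (real n + x)" "exp (- (x\<^sup>2 / (real n + x)))" "exp (- (x / (1 + y)))"]
    by (simp add: algebra_simps)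
  have "exp (- (x / (1 + y))) - exp (- x) \<le> (8 + 2 * a\<^sup>2 * exp (2 * a)) / real n"
  proof -
    \<comment> \<open>For negative \<open>x\<close> everything is controlled by \<open>a\<close>. In
      the middle range \<open>exp (- (x / 2))\<close> absorbs the square of \<open>x\<close>, whence
      the constant 8. Beyond \<open>n\<close> the upper estimate is itself below
      \<open>2 / n\<close>.\<close>
    consider "x < 0" | "0 \<le> x" "x \<le> real n" | "real n < x" by linarith
    then show ?thesis
    proof cases
      case 1
      have "- (x / (1 + y)) \<le> 2 * a"
      proof -
        have "- x \<le> a" using x by simp
        also have "a \<le> 2 * a * (1 + y)" using mult_left_mono[OF y1, of "2 * a"] a by simp
        finally show ?thesis using y0 by (simp add: field_simps)
      qed
      then have "exp (- (x / (1 + y))) \<le> exp (2 * a)" by simp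
      moreover have "x\<^sup>2 / (real n + x) \<le> a\<^sup>2 / (real n / 2)"
        using 1 x nx n a by (intro frac_le power2_le_iff_abs_le[THEN iffD2]) auto
      ultimately have "exp (- (x / (1 + y))) * (x\<^sup>2 / (real n + x)) \<le> exp (2 * a) * (a\<^sup>2 / (real n / 2))"
        using nx0 by (intro mult_mono) auto
      also have "\<dots> \<le> (8 + 2 * a\<^sup>2 * exp (2 * a)) / real n" using n by (simp add: field_simps)
      finally show ?thesis using diff by linarith
    next
      case 2
      have "1 + y \<le> 2" using 2 n by (simp add: y_def)
      then have "x / 2 \<le> x / (1 + y)" using 2 y0 by (intro divide_left_mono) auto
      then have e1: "exp (- (x / (1 + y))) \<le> exp (- (x / 2))" by simp
      have "1 + x / 2 + (x / 2)\<^sup>2 / 2 \<le> exp (x / 2)" using 2 by (intro exp_lower_Taylor_quadratic) simp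
      then have "x\<^sup>2 / 8 \<le> exp (x / 2)" using 2 by (simp add: power_divide)
      then have e2: "exp (- (x / 2)) * x\<^sup>2 \<le> 8" by (simp add: exp_minus field_simps)
      have "exp (- (x / (1 + y))) * (x\<^sup>2 / (real n + x)) \<le> exp (- (x / 2)) * (x\<^sup>2 / real n)"
        using 2 n e1 by (intro mult_mono divide_left_mono) auto
      also have "\<dots> \<le> 8 / real n" using e2 n by (simp add: field_simps)
      also have "\<dots> \<le> (8 + 2 * a\<^sup>2 * exp (2 * a)) / real n" using n by (intro divide_right_mono) auto
      finally show ?thesis using diff by linarith
    next
      case 3
      have "real n / 2 \<le> x / (1 + y)" using 3 n y0 by (simp add: y_def field_simps)
      then have "exp (- (x / (1 + y))) \<le> exp (- (real n / 2))" by simp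
      also have "\<dots> \<le> 2 / real n"
        using exp_ge_add_one_self[of "real n / 2"] n by (simp add: exp_minus field_simps)
      also have "\<dots> \<le> (8 + 2 * a\<^sup>2 * exp (2 * a)) / real n" using n by (intro divide_right_mono) auto
      finally show ?thesis using exp_gt_zero[of "- x"] by linarith
    qed
  qed
  with lower upper show ?thesis unfolding y_def[symmetric] by (simp add: abs_le_iff)
qed

text \<open>The scaling \<open>u = t * r\<close> reduces Balakrishnan's integral with the symbol
  \<open>r / (1 + t * r)\<close> to \<open>r powr \<alpha>\<close> times the integral of
  \<open>u powr (- \<alpha>) / (1 + u)\<close>. Here \<open>g\<close> is a primitive of that
  integrand and \<open>J\<close> the total mass. The value of \<open>J\<close> is not computed; its
  sign and the tail bound are what the application uses.\<close>

lemma ex_balakrishnan_primitive: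
  fixes \<alpha> :: real
  assumes \<alpha>: "0 < \<alpha>" "\<alpha> < 1"
  obtains g :: "real \<Rightarrow> real" and J where "0 < J" "g 0 = 0" "continuous_on {0..} g"
    "\<And>z. 0 < z \<Longrightarrow> (g has_real_derivative z powr (- \<alpha>) / (1 + z)) (at z)"
    "\<And>y z. 0 \<le> y \<Longrightarrow> y \<le> z \<Longrightarrow> g y \<le> g z"
    "\<And>z. 0 < z \<Longrightarrow> g z \<le> J" "\<And>z. 0 < z \<Longrightarrow> J - g z \<le> z powr (- \<alpha>) / \<alpha>"
proof -
  define q where "q v = 1 / (1 + v powr (1 / (1 - \<alpha>)))" for v :: real
  define m where "m y = integral {0..y} q" for y
  \<comment> \<open>The substitution \<open>v = u powr (1 - \<alpha>)\<close> removes the singularity of \<open>u powr (- \<alpha>) / (1 + u)\<close> at 0.\<close>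
  define g where "g z = m (z powr (1 - \<alpha>)) / (1 - \<alpha>)" for z
  have q: "continuous_on {0..b} q" for b
  proof -
    have "1 + v powr (1 / (1 - \<alpha>)) \<noteq> 0" for v :: real
      using powr_ge_zero[of v "1 / (1 - \<alpha>)"] by linarith
    then show ?thesis unfolding q_def using \<alpha>
      by (intro continuous_on_divide continuous_on_add continuous_on_const continuous_on_powr' continuous_on_id) auto
  qed
  have m_within: "(m has_real_derivative q y) (at y within {0..b})" if "y \<in> {0..b}" for y b
    using integral_has_real_derivative[OF q that] by (simp add: m_def[abs_def])
  have m_at: "(m has_real_derivative q y) (at y)" if "0 < y" for y
    using m_within[of y "y + 1"] that by (simp add: at_within_Icc_at)
  have m_cont: "continuous_on {0..} m"
    unfolding continuous_on_eq_continuous_within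
  proof
    fix y :: real assume y: "y \<in> {0..}"
    have "continuous (at y within {0..y + 1}) m"
      using m_within[of y "y + 1"] y by (intro DERIV_continuous) auto
    moreover have "at y within {0..y + 1} = at y within {0..}"
      using at_within_nhd[of y "{y - 1<..<y + 1}" "{0..y + 1}" "{0..}"] by force
    ultimately show "continuous (at y within {0..}) m" by simp
  qed
  have g0: "g 0 = 0" by (simp add: g_def m_def)
  have g_cont: "continuous_on {0..} g"
    unfolding g_def using \<alpha>
    by (intro continuous_on_divide continuous_on_const continuous_on_compose2[OF m_cont]
        continuous_on_powr' continuous_on_id) auto
  have g_der: "(g has_real_derivative z powr (- \<alpha>) / (1 + z)) (at z)" if z: "0 < z" for z
  proof -
    have "q (z powr (1 - \<alpha>)) = 1 / (1 + z)" using z \<alpha> by (simp add: q_def powr_powr)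
    moreover have "((\<lambda>z. z powr (1 - \<alpha>)) has_real_derivative (1 - \<alpha>) * z powr (- \<alpha>)) (at z)"
      using has_real_derivative_powr[OF z, of "1 - \<alpha>"] by simp
    moreover have "(m has_real_derivative q (z powr (1 - \<alpha>))) (at (z powr (1 - \<alpha>)))"
      using z by (intro m_at) simp
    ultimately have "((\<lambda>z. m (z powr (1 - \<alpha>))) has_real_derivative 1 / (1 + z) * ((1 - \<alpha>) * z powr (- \<alpha>))) (at z)"
      using DERIV_chain2[where g = "\<lambda>z. z powr (1 - \<alpha>)" and x = z and f = m] by metis
    from DERIV_cdivide[OF this, of "1 - \<alpha>"] show ?thesis
      using \<alpha> by (simp add: g_def[abs_def])
  qed
  have g_less: "g y < g z" if "0 \<le> y" "y < z" for y z
  proof (rule DERIV_pos_imp_increasing_open[OF that(2)])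
    show "\<exists>d. (g has_real_derivative d) (at x) \<and> 0 < d" if "y < x" "x < z" for x
      using g_der[of x] \<open>0 \<le> y\<close> that by (intro exI[of _ "x powr (- \<alpha>) / (1 + x)"]) auto
    show "continuous_on {y..z} g" by (rule continuous_on_subset[OF g_cont]) (use that in auto)
  qed
  have g_mono: "g y \<le> g z" if "0 \<le> y" "y \<le> z" for y z
    using g_less[of y z] that by (cases "y = z") auto
  \<comment> \<open>Adding \<open>x powr (- \<alpha>) / \<alpha>\<close> to \<open>g\<close> makes
    it nonincreasing, since \<open>1 / (1 + x) \<le> 1 / x\<close>. This bounds \<open>g\<close> and
    gives the rate at which it approaches its supremum.\<close>
  have tail: "g w \<le> g z + z powr (- \<alpha>) / \<alpha>" if "0 < w" "0 < z" for w z
  proof (cases "w \<le> z")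
    case True
    then show ?thesis using g_mono[of w z] that \<alpha> by (simp add: add_increasing2)
  next
    case False
    have "g w + w powr (- \<alpha>) / \<alpha> \<le> g z + z powr (- \<alpha>) / \<alpha>"
    proof (rule DERIV_nonpos_imp_nonincreasing[where f = "\<lambda>x. g x + x powr (- \<alpha>) / \<alpha>" and a = z and b = w])
      show "z \<le> w" using False by simp
      fix x assume x: "z \<le> x" "x \<le> w"
      then have x0: "0 < x" using that by simp
      have "((\<lambda>x. g x + x powr (- \<alpha>) / \<alpha>) has_real_derivative
          x powr (- \<alpha>) / (1 + x) + (- \<alpha>) * x powr (- \<alpha> - 1) / \<alpha>) (at x)"
        by (intro DERIV_add g_der x0 DERIV_cdivide has_real_derivative_powr)
      moreover have "x powr (- \<alpha>) / (1 + x) + (- \<alpha>) * x powr (- \<alpha> - 1) / \<alpha> \<le> 0"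
      proof -
        have "x powr (- \<alpha> - 1) = x powr (- \<alpha>) / x" using x0 by (simp add: powr_diff)
        moreover have "x powr (- \<alpha>) / (1 + x) \<le> x powr (- \<alpha>) / x"
          using x0 by (intro divide_left_mono) auto
        ultimately show ?thesis using \<alpha> by simp
      qed
      ultimately show "\<exists>d. ((\<lambda>x. g x + x powr (- \<alpha>) / \<alpha>) has_real_derivative d) (at x) \<and> d \<le> 0" by blast
    qed
    moreover have "0 \<le> w powr (- \<alpha>) / \<alpha>" using \<alpha> by simp
    ultimately show ?thesis by linarith
  qed
  define J where "J = (SUP z\<in>{0<..}. g z)"
  have bdd: "bdd_above (g ` {0<..})"
    using tail[of _ 1] by (intro bdd_aboveI[of _ "g 1 + 1 powr (- \<alpha>) / \<alpha>"]) auto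
  have le_J: "g z \<le> J" if "0 < z" for z
    unfolding J_def by (rule cSUP_upper[OF _ bdd]) (use that in simp)
  have J_le: "J - g z \<le> z powr (- \<alpha>) / \<alpha>" if "0 < z" for z
  proof -
    have "J \<le> g z + z powr (- \<alpha>) / \<alpha>"
      unfolding J_def by (rule cSUP_least) (use tail that in auto)
    then show ?thesis by simp
  qed
  have "0 < J" using le_J[of 1] g_less[of 0 1] g0 by simp
  from that[OF this g0 g_cont g_der g_mono le_J J_le] show thesis by blast
qed

text \<open>The value at \<open>r = 0\<close> is the limit of the exponential as \<open>r\<close>
  decreases to 0, for \<open>t > 0\<close>. At \<open>t = 0\<close> the symbol is 1 for
  \<open>r > 0\<close> and jumps at 0, so time zero always needs separate care.\<close>

definition semigroup_symbol :: "real \<Rightarrow> real \<Rightarrow> real \<Rightarrow> real" where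
  "semigroup_symbol k t r = (if r = 0 then 0 else exp (- (t * (1 / r - k))))"

lemma semigroup_symbol_nonneg: "0 \<le> semigroup_symbol k t r"
  by (simp add: semigroup_symbol_def)

lemma semigroup_symbol_le:
  assumes "0 < t" "0 \<le> r"
  shows "semigroup_symbol k t r \<le> exp (t * k) * r / t"
proof (cases "r = 0")
  case False
  then have r: "0 < r" using assms by simp
  have "t / r \<le> exp (t / r)" using exp_ge_add_one_self[of "t / r"] by linarith
  then have "exp (- (t / r)) \<le> r / t" using assms r by (simp add: exp_minus field_simps)
  moreover have "semigroup_symbol k t r = exp (t * k) * exp (- (t / r))"
    using False by (simp add: semigroup_symbol_def exp_add[symmetric] algebra_simps)
  ultimately show ?thesis using mult_left_mono[of "exp (- (t / r))" "r / t" "exp (t * k)"] by simp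
qed (simp add: semigroup_symbol_def)

text \<open>Joint continuity is what differentiation under the calculus asks for. At
  \<open>r = 0\<close> the symbol is squeezed between 0 and \<open>exp (t * k) * r / t\<close>,
  which tends to 0 locally uniformly in \<open>t > 0\<close>.\<close>

lemma continuous_on_semigroup_symbol_pair:
  "continuous_on ({0<..} \<times> {0..}) (\<lambda>(t, r). semigroup_symbol k t r)"
  unfolding continuous_on_def
proof (intro ballI)
  fix z :: "real \<times> real" assume z: "z \<in> {0<..} \<times> {0..}"
  let ?F = "at z within {0<..} \<times> {0..}"
  show "((\<lambda>(t, r). semigroup_symbol k t r) \<longlongrightarrow> (case z of (t, r) \<Rightarrow> semigroup_symbol k t r)) ?F"
  proof (cases "snd z = 0")
    case True
    have "((\<lambda>w. exp (fst w * k) * snd w / fst w) \<longlongrightarrow> exp (fst z * k) * snd z / fst z) ?F"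
      using z by (intro tendsto_intros) auto
    then have "((\<lambda>w. exp (fst w * k) * snd w / fst w) \<longlongrightarrow> 0) ?F" using True by simp
    then have "((\<lambda>w. semigroup_symbol k (fst w) (snd w)) \<longlongrightarrow> 0) ?F"
    proof (rule tendsto_sandwich[OF _ _ tendsto_const, rotated 2])
      show "\<forall>\<^sub>F w in ?F. 0 \<le> semigroup_symbol k (fst w) (snd w)"
        by (simp add: semigroup_symbol_nonneg)
      show "\<forall>\<^sub>F w in ?F. semigroup_symbol k (fst w) (snd w) \<le> exp (fst w * k) * snd w / fst w"
        unfolding eventually_at_filter by (auto intro!: always_eventually semigroup_symbol_le)
    qed
    then show ?thesis using True by (simp add: case_prod_unfold semigroup_symbol_def)
  next
    case False
    then have r: "0 < snd z" using z by (cases z) auto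
    have "(snd \<longlongrightarrow> snd z) ?F" by (intro tendsto_intros)
    then have "\<forall>\<^sub>F w in ?F. 0 < snd w" using r by (rule order_tendstoD)
    then have "\<forall>\<^sub>F w in ?F. exp (- (fst w * (1 / snd w - k))) = (case w of (t, r) \<Rightarrow> semigroup_symbol k t r)"
      by eventually_elim (auto simp: semigroup_symbol_def)
    moreover have "((\<lambda>w. exp (- (fst w * (1 / snd w - k)))) \<longlongrightarrow> exp (- (fst z * (1 / snd z - k)))) ?F"
      using False by (intro tendsto_intros) auto
    ultimately show ?thesis
      using False by (auto simp: semigroup_symbol_def case_prod_unfold elim: Lim_transform_eventually)
  qed
qed

lemma continuous_on_semigroup_symbol:
  assumes "0 < t"
  shows "continuous_on {0..c} (semigroup_symbol k t)"
proof -
  have "continuous_on {0..c} (Pair t)" by (intro continuous_on_Pair continuous_on_id continuous_on_const)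
  moreover have "Pair t ` {0..c} \<subseteq> {0<..} \<times> {0..}" using assms by auto
  ultimately show ?thesis
    using continuous_on_compose2[OF continuous_on_semigroup_symbol_pair[of k], of "{0..c}" "Pair t"] by simp
qed


subsection \<open>Resolvents, fractional powers and the semigroup as functions of the inverse\<close>

locale shifted_positive_operator = positive_operator R c
  for R :: "'a::{real_inner,complete_space} \<Rightarrow> 'a" and c :: real +
  fixes D :: "'a set" and A :: "'a \<Rightarrow> 'a" and k :: real
  assumes k_nonneg: "0 \<le> k"
    and R_in_D: "R x \<in> D"
    and A_R: "A (R x) + k *\<^sub>R R x = x"
    and R_A: "y \<in> D \<Longrightarrow> R (A y + k *\<^sub>R y) = y"
begin

text \<open>One statement covers both kinds of resolvent: \<open>t + B\<close> for Balakrishnan's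
  formula and \<open>1 + (t / n) A\<close> for the exponential formula. The operator
  \<open>a + b B\<close> has the symbol \<open>a + b / r\<close>, whose reciprocal is the one given
  here.\<close>

lemma inv_into_resolvent:
  assumes ab: "0 \<le> a" "0 < b" and J: "\<And>y. y \<in> D \<Longrightarrow> J y = a *\<^sub>R y + b *\<^sub>R (A y + k *\<^sub>R y)"
  shows "inv_into D J x = phi (\<lambda>r. r / (a * r + b)) x"
proof (rule inv_into_f_eq)
  define h where "h r = 1 / (a * r + b)" for r
  have pos: "a * r + b \<noteq> 0" if "r \<in> {0..c}" for r
  proof -
    have "0 \<le> a * r" using ab that by simp
    then show ?thesis using ab by linarith
  qed
  then have h: "continuous_on {0..c} h" unfolding h_def by (intro continuous_intros) auto
  have y: "phi (\<lambda>r. r / (a * r + b)) x = R (phi h x)"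
    using phi_mult[OF continuous_on_id h, of x] phi_id by (simp add: h_def)
  show "phi (\<lambda>r. r / (a * r + b)) x \<in> D" unfolding y by (rule R_in_D)
  have rh: "continuous_on {0..c} (\<lambda>r. r * h r)" by (intro continuous_intros h)
  have "J (R (phi h x)) = a *\<^sub>R R (phi h x) + b *\<^sub>R phi h x"
    using J[OF R_in_D] A_R by simp
  also have "\<dots> = phi (\<lambda>r. a * (r * h r) + b * h r) x"
    using phi_add[OF continuous_on_mult_left[OF rh, of a] continuous_on_mult_left[OF h, of b], of x]
      phi_scale[OF rh, of a x] phi_scale[OF h, of b x] phi_mult[OF continuous_on_id h, of x] phi_id by simp
  also have "\<dots> = phi (\<lambda>r. 1) x"
    by (rule phi_cong) (use pos in \<open>simp add: h_def add_divide_distrib[symmetric]\<close>)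
  also have "\<dots> = x" by (rule phi_1)
  finally show "J (phi (\<lambda>r. r / (a * r + b)) x) = x" unfolding y .
  show "inj_on J D"
  proof (rule inj_onI)
    fix y1 y2 assume y: "y1 \<in> D" "y2 \<in> D" "J y1 = J y2"
    \<comment> \<open>Injectivity is tested on \<open>d = B (y1 - y2)\<close>: the equation
      \<open>a R d + b d = 0\<close> paired with \<open>d\<close> forces \<open>d = 0\<close>, as
      \<open>R\<close> is positive and \<open>b > 0\<close>.\<close>
    define d where "d = (A y1 + k *\<^sub>R y1) - (A y2 + k *\<^sub>R y2)"
    have Rd: "R d = y1 - y2" using R_A y(1,2) by (simp add: d_def R_simps)
    have "a *\<^sub>R R d + b *\<^sub>R d = 0"
      using y(3) J[OF y(1)] J[OF y(2)] unfolding Rd by (simp add: d_def algebra_simps)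
    then have "a * inner (R d) d + b * inner d d = 0"
      by (metis inner_add_left inner_scaleR_left inner_zero_left)
    moreover have "0 \<le> a * inner (R d) d" using ab inner_R_ge_0 by simp
    moreover have "0 \<le> b * inner d d" using ab by simp
    ultimately have "b * inner d d = 0" by linarith
    then have "d = 0" using ab by simp
    with Rd show "y1 = y2" by (simp add: R_simps)
  qed
qed

lemma op_semigroup_eq_phi:
  assumes t: "0 < t"
  shows "op_semigroup D A t x = phi (semigroup_symbol k t) x"
proof -
  define a where "a = t * k"
  have a0: "0 \<le> a" using t k_nonneg by (simp add: a_def)
  define C where "C = 8 + 2 * a\<^sup>2 * exp (2 * a)"
  \<comment> \<open>As \<open>A = B - k\<close>, the operator \<open>1 + (t / n) A\<close> equals
    \<open>(1 - a / n) + (t / n) B\<close> with \<open>a = t * k\<close>. Its first coefficient is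
    nonnegative once \<open>n \<ge> a\<close>, so only large \<open>n\<close> are
    considered.\<close>
  define \<rho> where "\<rho> n r = r / ((1 - a / real n) * r + t / real n)" for n :: nat and r :: real
  have bnd: "norm ((inv_into D (\<lambda>y. y + (t / real n) *\<^sub>R A y) ^^ n) x - phi (semigroup_symbol k t) x)
      \<le> C / real n * norm x" if n: "0 < n" "2 * a \<le> real n" for n
  proof -
    have an: "0 \<le> 1 - a / real n" using n a0 by (simp add: field_simps)
    have tn: "0 < t / real n" using t n by simp
    have "inv_into D (\<lambda>y. y + (t / real n) *\<^sub>R A y) = phi (\<rho> n)"
    proof
      fix x
      show "inv_into D (\<lambda>y. y + (t / real n) *\<^sub>R A y) x = phi (\<rho> n) x"
        unfolding \<rho>_def
        by (rule inv_into_resolvent[OF an tn]) (simp add: a_def algebra_simps)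
    qed
    moreover have pos: "(1 - a / real n) * r + t / real n > 0" if "0 \<le> r" for r
      using an tn that by (simp add: add_nonneg_pos)
    have \<rho>: "continuous_on {0..c} (\<rho> n)"
      unfolding \<rho>_def using pos by (intro continuous_intros) (auto simp: less_imp_neq[THEN not_sym])
    moreover have "phi (\<lambda>r. \<rho> n r ^ n) x - phi (semigroup_symbol k t) x
        = phi (\<lambda>r. \<rho> n r ^ n - semigroup_symbol k t r) x"
      by (intro phi_diff[symmetric] continuous_intros \<rho> continuous_on_semigroup_symbol t)
    moreover have "norm (phi (\<lambda>r. \<rho> n r ^ n - semigroup_symbol k t r) x) \<le> C / real n * norm x"
    proof (rule norm_phi_le)
      show "continuous_on {0..c} (\<lambda>r. \<rho> n r ^ n - semigroup_symbol k t r)"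
        by (intro continuous_intros \<rho> continuous_on_semigroup_symbol t)
      fix r assume r: "r \<in> {0..c}"
      show "\<bar>\<rho> n r ^ n - semigroup_symbol k t r\<bar> \<le> C / real n"
      proof (cases "r = 0")
        case True
        moreover have "0 \<le> C" by (simp add: C_def)
        ultimately show ?thesis using n by (simp add: \<rho>_def semigroup_symbol_def power_0_left)
      next
        case False
        then have r0: "0 < r" using r by simp
        define x where "x = t * (1 / r - k)"
        have "- a \<le> x" using t r0 by (simp add: x_def a_def algebra_simps)
        from abs_inverse_power_minus_exp_le[OF a0 this n]
        have "\<bar>(1 / (1 + x / real n)) ^ n - exp (- x)\<bar> \<le> C / real n" by (simp add: C_def)
        moreover have "1 / (1 + x / real n) = \<rho> n r"
        proof -
          have "1 + x / real n = ((1 - a / real n) * r + t / real n) / r"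
            using r0 n by (simp add: x_def a_def field_simps)
          then show ?thesis by (simp add: \<rho>_def)
        qed
        ultimately show ?thesis using False by (simp add: semigroup_symbol_def x_def)
      qed
    qed
    ultimately show ?thesis by (simp add: phi_power)
  qed
  have "(\<lambda>n. (inv_into D (\<lambda>y. y + (t / real n) *\<^sub>R A y) ^^ n) x) \<longlonglongrightarrow> phi (semigroup_symbol k t) x"
  proof (rule LIM_zero_cancel, rule Lim_null_comparison)
    obtain N :: nat where N: "2 * a \<le> real N" using real_arch_simple by blast
    show "\<forall>\<^sub>F n in sequentially. norm ((inv_into D (\<lambda>y. y + (t / real n) *\<^sub>R A y) ^^ n) x
        - phi (semigroup_symbol k t) x) \<le> C / real n * norm x"
      using eventually_ge_at_top[of "Suc N"] by eventually_elim (rule bnd, use N in auto)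
    show "(\<lambda>n. C / real n * norm x) \<longlonglongrightarrow> 0"
      by (intro tendsto_mult_left_zero lim_const_over_n)
  qed
  then show ?thesis using t by (simp add: op_semigroup_def limI)
qed

text \<open>The factor is \<open>sin (pi * \<alpha>) / pi * J\<close>. Only its nonvanishing is
  recorded, which is enough to divide it out of later estimates.\<close>

lemma frac_neg_power_eq_phi:
  assumes \<alpha>: "0 < \<alpha>" "\<alpha> < 1"
  obtains \<kappa> where "\<kappa> \<noteq> 0"
    "\<And>x. frac_neg_power D (\<lambda>x. A x + k *\<^sub>R x) \<alpha> x = \<kappa> *\<^sub>R phi (\<lambda>r. r powr \<alpha>) x"
proof -
  obtain g :: "real \<Rightarrow> real" and J where J: "0 < J" and g0: "g 0 = 0" and gc: "continuous_on {0..} g"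
    and gd: "\<And>z. 0 < z \<Longrightarrow> (g has_real_derivative z powr (- \<alpha>) / (1 + z)) (at z)"
    and gm: "\<And>y z. 0 \<le> y \<Longrightarrow> y \<le> z \<Longrightarrow> g y \<le> g z"
    and gJ: "\<And>z. 0 < z \<Longrightarrow> g z \<le> J" and Jg: "\<And>z. 0 < z \<Longrightarrow> J - g z \<le> z powr (- \<alpha>) / \<alpha>"
    using ex_balakrishnan_primitive[OF \<alpha>] by metis
  \<comment> \<open>In \<open>t\<close>, \<open>G\<close> is the primitive, vanishing at 0, of the
    Balakrishnan symbol \<open>H\<close>, obtained from \<open>g\<close> by the scaling
    \<open>u = t * r\<close>. As \<open>H\<close> is singular at \<open>t = 0\<close>,
    differentiability is shown for \<open>t > 0\<close> and only continuity at 0.\<close>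
  define G where "G t r = r powr \<alpha> * g (t * r)" for t r
  define H where "H t r = t powr (- \<alpha>) * (r / (t * r + 1))" for t r
  have pw: "continuous_on {0..c} (\<lambda>r. r powr \<alpha>)"
    using \<alpha> by (intro continuous_on_powr' continuous_on_id continuous_on_const) auto
  have G_cont: "continuous_on {0..c} (G t)" if "0 \<le> t" for t
    unfolding G_def by (intro continuous_intros pw continuous_on_compose2[OF gc]) (use that in auto)
  have H_cont: "continuous_on ({a..b} \<times> {0..c}) (\<lambda>(t, r). H t r)" if "0 < a" for a b
  proof -
    have "t * r + 1 \<noteq> 0" if "a \<le> t" "0 \<le> r" for t r
      using mult_nonneg_nonneg[of t r] that \<open>0 < a\<close> by linarith
    then show ?thesis
      unfolding H_def case_prod_unfold using that
      by (intro continuous_on_mult continuous_on_divide continuous_on_add continuous_on_powr continuous_intros) auto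
  qed
  have G_der: "((\<lambda>t. G t r) has_real_derivative H t r) (at t)" if t: "0 < t" and r: "0 \<le> r" for t r
  proof (cases "r = 0")
    case True
    then show ?thesis by (simp add: G_def H_def)
  next
    case False
    then have r: "0 < r" using r by simp
    have "((\<lambda>t. g (t * r)) has_real_derivative (t * r) powr (- \<alpha>) / (1 + t * r) * r) (at t)"
    proof (rule DERIV_chain2[where g = "\<lambda>t. t * r" and x = t])
      show "(g has_real_derivative (t * r) powr (- \<alpha>) / (1 + t * r)) (at (t * r))"
        using t r by (intro gd) simp
      show "((\<lambda>t. t * r) has_real_derivative r) (at t)"
        by (auto intro!: derivative_eq_intros)
    qed
    from DERIV_cmult[OF this, of "r powr \<alpha>"]
    have "((\<lambda>t. G t r) has_real_derivative r powr \<alpha> * ((t * r) powr (- \<alpha>) / (1 + t * r) * r)) (at t)"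
      by (simp add: G_def)
    moreover have "r powr \<alpha> * ((t * r) powr (- \<alpha>) / (1 + t * r) * r) = H t r"
    proof -
      have "r powr \<alpha> * (t * r) powr (- \<alpha>) = t powr (- \<alpha>)"
        using t r by (simp add: powr_mult powr_minus field_simps)
      then have "r powr \<alpha> * ((t * r) powr (- \<alpha>) / (1 + t * r) * r) = t powr (- \<alpha>) / (1 + t * r) * r"
        by (metis (no_types, lifting) mult.assoc times_divide_eq_right)
      then show ?thesis by (simp add: H_def add.commute)
    qed
    ultimately show ?thesis by simp
  qed
  have F_der: "((\<lambda>t. phi (G t) x) has_vector_derivative phi (H t) x) (at t)" if "0 < t" for t x
  proof (rule phi_has_vector_derivative[where a = "t / 2" and b = "2 * t" and G = G and H = H])
    show "continuous_on ({t / 2..2 * t} \<times> {0..c}) (\<lambda>(t, r). H t r)" by (rule H_cont) (use that in simp)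
    show "continuous_on {0..c} (G s)" if "s \<in> {t / 2..2 * t}" for s
      by (rule G_cont) (use that \<open>0 < t\<close> in simp)
    show "((\<lambda>t. G t r) has_real_derivative H s r) (at s)" if "s \<in> {t / 2..2 * t}" "r \<in> {0..c}" for s r
      by (rule G_der) (use that \<open>0 < t\<close> in auto)
    show "t \<in> {t / 2<..<2 * t}" using that by simp
  qed
  have F0: "phi (G 0) x = 0" for x
  proof -
    have "norm (phi (G 0) x) \<le> 0 * norm x" by (rule norm_phi_le[OF G_cont[OF order_refl]]) (simp add: G_def g0)
    then show ?thesis by simp
  qed
  have F_cont: "continuous_on {0..b} (\<lambda>t. phi (G t) x)" for x b
  proof (rule continuous_on_eq_continuous_within[THEN iffD2], rule ballI)
    fix t assume t: "t \<in> {0..b}"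
    show "continuous (at t within {0..b}) (\<lambda>t. phi (G t) x)"
    proof (cases "t = 0")
      case False
      then have "0 < t" using t by simp
      from has_vector_derivative_continuous[OF F_der[OF this]] show ?thesis
        by (rule continuous_at_imp_continuous_within)
    next
      case True
      have "((\<lambda>t. phi (G t) x) \<longlongrightarrow> 0) (at 0 within {0..b})"
      proof (rule Lim_null_comparison)
        show "\<forall>\<^sub>F t in at 0 within {0..b}. norm (phi (G t) x) \<le> c powr \<alpha> * g (t * c) * norm x"
          unfolding eventually_at_filter
        proof (intro always_eventually allI impI norm_phi_le)
          fix t r assume t: "t \<in> {0..b}" and r: "r \<in> {0..c}"
          have "0 \<le> g (t * r)" using gm[of 0 "t * r"] g0 t r by simp
          moreover have "g (t * r) \<le> g (t * c)" using t r by (intro gm mult_left_mono) auto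
          moreover have "r powr \<alpha> \<le> c powr \<alpha>" using r \<alpha> by (intro powr_mono2) auto
          ultimately show "\<bar>G t r\<bar> \<le> c powr \<alpha> * g (t * c)"
            by (auto simp: G_def abs_mult intro!: mult_mono)
        qed (use G_cont in auto)
        have "continuous_on {0..b} (\<lambda>t. c powr \<alpha> * g (t * c) * norm x)"
          using c_pos by (intro continuous_intros continuous_on_compose2[OF gc]) auto
        then have "((\<lambda>t. c powr \<alpha> * g (t * c) * norm x) \<longlongrightarrow> c powr \<alpha> * g (0 * c) * norm x) (at 0 within {0..b})"
          using t True unfolding continuous_on_def by blast
        then show "((\<lambda>t. c powr \<alpha> * g (t * c) * norm x) \<longlongrightarrow> 0) (at 0 within {0..b})" by (simp add: g0)
      qed
      then show ?thesis using True by (simp add: continuous_within F0)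
    qed
  qed
  have int: "((\<lambda>t. phi (H t) x) has_integral phi (G b) x) {0..b}" if "0 \<le> b" for x b
    using fundamental_theorem_of_calculus_interior[OF that F_cont, of x "\<lambda>t. phi (H t) x"] F_der F0 by simp
  \<comment> \<open>The tail of \<open>g\<close> at \<open>b * r\<close> is at most
    \<open>(b * r) powr (- \<alpha>) / \<alpha>\<close>, and the prefactor
    \<open>r powr \<alpha>\<close> cancels its dependence on \<open>r\<close>. Hence the convergence
    is in operator norm.\<close>
  have F_inf: "norm (phi (G b) x - phi (\<lambda>r. J * r powr \<alpha>) x) \<le> b powr (- \<alpha>) / \<alpha> * norm x" if b: "0 < b" for b x
  proof -
    have "phi (G b) x - phi (\<lambda>r. J * r powr \<alpha>) x = phi (\<lambda>r. G b r - J * r powr \<alpha>) x"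
      by (intro phi_diff[symmetric] G_cont continuous_intros pw) (use b in auto)
    also have "norm \<dots> \<le> b powr (- \<alpha>) / \<alpha> * norm x"
    proof (rule norm_phi_le)
      show "continuous_on {0..c} (\<lambda>r. G b r - J * r powr \<alpha>)"
        by (intro continuous_on_diff G_cont continuous_on_mult_left pw) (use b in auto)
      fix r assume r: "r \<in> {0..c}"
      show "\<bar>G b r - J * r powr \<alpha>\<bar> \<le> b powr (- \<alpha>) / \<alpha>"
      proof (cases "r = 0")
        case True
        then show ?thesis using \<alpha> by (simp add: G_def)
      next
        case False
        then have r0: "0 < r" using r by simp
        then have br: "0 < b * r" using b by simp
        have "\<bar>G b r - J * r powr \<alpha>\<bar> = r powr \<alpha> * \<bar>J - g (b * r)\<bar>"
        proof -
          have "G b r - J * r powr \<alpha> = - (r powr \<alpha> * (J - g (b * r)))" by (simp add: G_def algebra_simps)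
          then show ?thesis by (simp add: abs_mult)
        qed
        also have "\<dots> \<le> r powr \<alpha> * ((b * r) powr (- \<alpha>) / \<alpha>)"
          using gJ[OF br] Jg[OF br] by (intro mult_left_mono) auto
        also have "\<dots> = b powr (- \<alpha>) / \<alpha>"
          using b r0 by (simp add: powr_mult powr_minus field_simps)
        finally show ?thesis .
      qed
    qed
    finally show ?thesis .
  qed
  have total: "((\<lambda>t. phi (H t) x) has_integral phi (\<lambda>r. J * r powr \<alpha>) x) {0<..}" for x
  proof -
    \<comment> \<open>For a set that is not a box, the integral is defined by exhaustion with large
      boxes. A box around \<open>{0..B}\<close> contributes nothing on its negative part and
      \<open>phi (G b) x\<close> on \<open>{0..b}\<close>.\<close>
    have "\<nexists>a b. {0<..} = cbox a (b::real)"
    proof (intro notI, elim exE)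
      fix a b :: real assume "{0<..} = cbox a b"
      then have "bounded {(0::real)<..}" by (metis bounded_cbox)
      then obtain M where "\<forall>x\<in>{(0::real)<..}. norm x \<le> M" by (auto simp: bounded_iff)
      moreover have "\<bar>M\<bar> + 1 \<in> {0<..}" by (simp add: add_nonneg_pos)
      ultimately have "norm (\<bar>M\<bar> + 1) \<le> M" by blast
      then show False by simp
    qed
    moreover have "\<exists>B>0. \<forall>a b. ball 0 B \<subseteq> cbox a b \<longrightarrow>
        (\<exists>z. ((\<lambda>t. if t \<in> {0<..} then phi (H t) x else 0) has_integral z) (cbox a b)
           \<and> norm (z - phi (\<lambda>r. J * r powr \<alpha>) x) < e)" if e: "0 < e" for e
    proof -
      have "((\<lambda>b. b powr (- \<alpha>) / \<alpha> * norm x) \<longlongrightarrow> 0) at_top"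
        using \<alpha> by (intro tendsto_mult_left_zero tendsto_divide_zero tendsto_neg_powr filterlim_ident) auto
      then have "\<forall>\<^sub>F b in at_top. b powr (- \<alpha>) / \<alpha> * norm x < e"
        using e by (intro order_tendstoD) auto
      then obtain B where B: "0 < B" "\<And>b. B \<le> b \<Longrightarrow> b powr (- \<alpha>) / \<alpha> * norm x < e"
        unfolding eventually_at_top_linorder by (metis gt_ex less_le_trans max.bounded_iff max.cobounded2 zero_less_one)
      show ?thesis
      proof (intro exI[of _ B] conjI allI impI B(1))
        fix a b :: real assume sub: "ball 0 B \<subseteq> cbox a b"
        have ab: "a \<le> 0" "B \<le> b"
        proof -
          have "cball 0 B \<subseteq> cbox a b" using closure_minimal[OF sub closed_cbox] B(1) by simp
          moreover have "0 \<in> cball 0 B" "B \<in> cball 0 B" using B(1) by auto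
          ultimately have "0 \<in> cbox a b" "B \<in> cbox a b" by blast+
          then show "a \<le> 0" "B \<le> b" by simp_all
        qed
        have "((\<lambda>t. if t \<in> {0<..} then phi (H t) x else 0) has_integral (0 + phi (G b) x)) (cbox a b)"
        proof (rule has_integral_split[where k = "1::real" and c = 0])
          show "((\<lambda>t. if t \<in> {0<..} then phi (H t) x else 0) has_integral 0) (cbox a b \<inter> {x. x \<bullet> 1 \<le> 0})"
            by (rule has_integral_is_0) auto
          have "cbox a b \<inter> {x. 0 \<le> x \<bullet> 1} = {0..b}" using ab by auto
          moreover have "((\<lambda>t. if t \<in> {0<..} then phi (H t) x else 0) has_integral phi (G b) x) {0..b}"
            by (rule has_integral_spike_finite[OF _ _ int, of "{0}"]) (use ab B(1) in auto)
          ultimately show "((\<lambda>t. if t \<in> {0<..} then phi (H t) x else 0) has_integral phi (G b) x)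
              (cbox a b \<inter> {x. 0 \<le> x \<bullet> 1})" by simp
        qed simp
        then show "\<exists>z. ((\<lambda>t. if t \<in> {0<..} then phi (H t) x else 0) has_integral z) (cbox a b)
           \<and> norm (z - phi (\<lambda>r. J * r powr \<alpha>) x) < e"
          using F_inf[of b x] B(2)[OF ab(2)] B(1) ab by (intro exI[of _ "phi (G b) x"]) auto
      qed
    qed
    ultimately show ?thesis by (subst has_integral_alt) auto
  qed
  have "integral {0<..} (\<lambda>t. t powr (- \<alpha>) *\<^sub>R inv_into D (\<lambda>y. A y + k *\<^sub>R y + t *\<^sub>R y) x)
      = J *\<^sub>R phi (\<lambda>r. r powr \<alpha>) x" for x
  proof -
    have "integral {0<..} (\<lambda>t. t powr (- \<alpha>) *\<^sub>R inv_into D (\<lambda>y. A y + k *\<^sub>R y + t *\<^sub>R y) x)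
        = integral {0<..} (\<lambda>t. phi (H t) x)"
    proof (rule integral_cong)
      fix t :: real assume t: "t \<in> {0<..}"
      have "continuous_on {0..c} (\<lambda>r. r / (t * r + 1))"
        using t by (intro continuous_intros) (auto simp: add_nonneg_eq_0_iff)
      moreover have "inv_into D (\<lambda>y. A y + k *\<^sub>R y + t *\<^sub>R y) x = phi (\<lambda>r. r / (t * r + 1)) x"
        by (rule inv_into_resolvent) (use t in auto)
      ultimately show "t powr (- \<alpha>) *\<^sub>R inv_into D (\<lambda>y. A y + k *\<^sub>R y + t *\<^sub>R y) x = phi (H t) x"
        using phi_scale[of "\<lambda>r. r / (t * r + 1)" "t powr (- \<alpha>)" x] by (simp add: H_def[abs_def])
    qed
    also have "\<dots> = J *\<^sub>R phi (\<lambda>r. r powr \<alpha>) x"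
      using integral_unique[OF total[of x]] phi_scale[OF pw] by simp
    finally show ?thesis .
  qed
  then have "frac_neg_power D (\<lambda>x. A x + k *\<^sub>R x) \<alpha> x = (sin (pi * \<alpha>) / pi * J) *\<^sub>R phi (\<lambda>r. r powr \<alpha>) x" for x
    using \<alpha> by (simp add: frac_neg_power_def)
  moreover have "sin (pi * \<alpha>) / pi * J \<noteq> 0"
    using J \<alpha> sin_gt_zero[of "pi * \<alpha>"] by simp
  ultimately show thesis using that by blast
qed

end

subsection \<open>Smoothing estimates\<close>

lemma has_integral_powr_diff:
  fixes t \<tau> \<beta> :: real
  assumes "0 \<le> \<tau>" "\<beta> < 1"
  shows "((\<lambda>s. (t - s) powr (- \<beta>)) has_integral \<tau> powr (1 - \<beta>) / (1 - \<beta>)) {t - \<tau>..t}"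
proof -
  have "((\<lambda>s. (t - s) powr (- \<beta>)) has_integral
      (- ((t - t) powr (1 - \<beta>)) / (1 - \<beta>)) - (- ((t - (t - \<tau>)) powr (1 - \<beta>)) / (1 - \<beta>))) {t - \<tau>..t}"
  proof (rule fundamental_theorem_of_calculus_interior[where f = "\<lambda>s. - ((t - s) powr (1 - \<beta>)) / (1 - \<beta>)"])
    show "continuous_on {t - \<tau>..t} (\<lambda>s. - ((t - s) powr (1 - \<beta>)) / (1 - \<beta>))"
      using assms by (intro continuous_on_divide continuous_on_minus continuous_on_powr' continuous_on_diff
          continuous_on_const continuous_on_id) auto
    fix s assume "s \<in> {t - \<tau><..<t}"
    then have s: "0 < t - s" by simp
    have "((\<lambda>s. (t - s) powr (1 - \<beta>)) has_real_derivative (1 - \<beta>) * (t - s) powr (1 - \<beta> - 1) * (- 1)) (at s)"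
      by (rule DERIV_chain2[where g = "\<lambda>s. t - s" and x = s and f = "\<lambda>z. z powr (1 - \<beta>)"])
         (auto intro!: derivative_eq_intros has_real_derivative_powr s)
    from DERIV_cdivide[OF DERIV_minus[OF this], of "1 - \<beta>"]
    show "((\<lambda>s. - ((t - s) powr (1 - \<beta>)) / (1 - \<beta>)) has_vector_derivative (t - s) powr (- \<beta>)) (at s)"
      using assms by (simp add: has_real_derivative_iff_has_vector_derivative)
  qed (use assms in simp)
  then show ?thesis by simp
qed

text \<open>The lemma is scalar because it is applied to vector-valued integrals after pairing with
  a test vector, where no integrability of norms has to be known.\<close>

lemma abs_integral_le_powr:
  fixes F :: "real \<Rightarrow> real"
  assumes F: "(F has_integral I) {t - \<tau>..t}" and "0 \<le> \<tau>" "\<beta> < 1"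
    and bound: "\<And>s. t - \<tau> \<le> s \<Longrightarrow> s < t \<Longrightarrow> \<bar>F s\<bar> \<le> M * (t - s) powr (- \<beta>)"
  shows "\<bar>I\<bar> \<le> M * (\<tau> powr (1 - \<beta>) / (1 - \<beta>))"
proof -
  \<comment> \<open>At \<open>s = t\<close> the majorant is \<open>0 powr (- \<beta>) = 0\<close>,
    so the integrand is changed to 0 at this one point.\<close>
  define F' where "F' s = (if s = t then 0 else F s)" for s
  have F': "(F' has_integral I) {t - \<tau>..t}"
    by (rule has_integral_spike_finite[OF _ _ F, of "{t}"]) (auto simp: F'_def)
  have G: "((\<lambda>s. M * (t - s) powr (- \<beta>)) has_integral M * (\<tau> powr (1 - \<beta>) / (1 - \<beta>))) {t - \<tau>..t}"
    by (intro has_integral_mult_right has_integral_powr_diff assms)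
  have b: "\<bar>F' s\<bar> \<le> M * (t - s) powr (- \<beta>)" if "s \<in> {t - \<tau>..t}" for s
    using that bound[of s] by (auto simp: F'_def)
  have "I \<le> M * (\<tau> powr (1 - \<beta>) / (1 - \<beta>))"
    by (rule has_integral_le[OF F' G]) (use b abs_le_D1 in blast)
  moreover have "- I \<le> M * (\<tau> powr (1 - \<beta>) / (1 - \<beta>))"
    by (rule has_integral_le[OF has_integral_neg[OF F'] G]) (use b abs_le_D2 in blast)
  ultimately show ?thesis by simp
qed

lemma powr_le_exp:
  fixes z :: real
  assumes "0 \<le> z" "0 \<le> \<beta>" "\<beta> \<le> 1"
  shows "z powr \<beta> \<le> exp z"
proof (cases "z \<le> 1")
  case True
  then have "z powr \<beta> \<le> 1" using assms by (intro powr_le1) auto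
  then show ?thesis using assms one_le_exp_iff[of z] by linarith
next
  case False
  then have "z powr \<beta> \<le> z powr 1" using assms by (intro powr_mono) auto
  also have "z powr 1 = z" using assms by simp
  also have "z \<le> exp z" using exp_ge_add_one_self[of z] by linarith
  finally show ?thesis .
qed

text \<open>Both sides are separated by \<open>min 1 z\<close>. This inequality is the source of the
  Hoelder exponent.\<close>

lemma one_minus_exp_le_powr:
  fixes z :: real
  assumes "0 \<le> z" "0 \<le> \<theta>" "\<theta> \<le> 1"
  shows "1 - exp (- z) \<le> z powr \<theta>"
proof (cases "z = 0")
  case False
  show ?thesis
  proof (cases "z \<le> 1")
    case True
    have "z powr 1 \<le> z powr \<theta>" using assms True False by (intro powr_mono') auto
    then show ?thesis using assms exp_ge_add_one_self[of "- z"] by simp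
  next
    case False
    then have "1 \<le> z powr \<theta>" using assms by (intro ge_one_powr_ge_zero) auto
    then show ?thesis using exp_gt_zero[of "- z"] by linarith
  qed
qed simp

text \<open>The symbol of \<open>B powr \<beta>\<close> applied to the semigroup, where \<open>B = A + k\<close> has symbol \<open>1 / r\<close>.\<close>

definition weighted_symbol :: "real \<Rightarrow> real \<Rightarrow> real \<Rightarrow> real \<Rightarrow> real" where
  "weighted_symbol k \<beta> t r = (if r = 0 then 0 else r powr (- \<beta>) * exp (- (t * (1 / r - k))))"

lemma weighted_symbol_nonneg: "0 \<le> weighted_symbol k \<beta> t r"
  by (simp add: weighted_symbol_def)

text \<open>The smoothing estimate for \<open>B powr \<beta>\<close> composed with the semigroup is
  the inequality \<open>z powr \<beta> \<le> exp z\<close> at \<open>z = t / r\<close>; the shift by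
  \<open>k\<close> accounts for \<open>exp (t * k)\<close>.\<close>

lemma weighted_symbol_le:
  assumes "0 < t" "0 \<le> r" "0 \<le> \<beta>" "\<beta> \<le> 1"
  shows "weighted_symbol k \<beta> t r \<le> exp (t * k) * t powr (- \<beta>)"
proof (cases "r = 0")
  case False
  then have r: "0 < r" using assms by simp
  have "(t / r) powr \<beta> \<le> exp (t / r)" using assms r by (intro powr_le_exp) auto
  then have "r powr (- \<beta>) * exp (- (t / r)) \<le> t powr (- \<beta>)"
    using assms r by (simp add: powr_divide powr_minus exp_minus field_simps)
  moreover have "weighted_symbol k \<beta> t r = exp (t * k) * (r powr (- \<beta>) * exp (- (t / r)))"
    using False by (simp add: weighted_symbol_def exp_add[symmetric] algebra_simps)
  ultimately show ?thesis using mult_left_mono[of "r powr (- \<beta>) * exp (- (t / r))" "t powr (- \<beta>)" "exp (t * k)"] by simp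
qed (simp add: weighted_symbol_def)

text \<open>Half of the time pays for the unbounded weight and the other half still decays as
  \<open>r\<close> tends to 0; this gives continuity of the weighted symbol at 0.\<close>

lemma weighted_symbol_split:
  "weighted_symbol k \<beta> t r = weighted_symbol k \<beta> (t / 2) r * semigroup_symbol k (t / 2) r"
  by (simp add: weighted_symbol_def semigroup_symbol_def exp_add[symmetric] field_simps)

lemma continuous_on_weighted_symbol:
  assumes t: "0 < t" and \<beta>: "0 \<le> \<beta>" "\<beta> \<le> 1"
  shows "continuous_on {0..c} (weighted_symbol k \<beta> t)"
  unfolding continuous_on_def
proof (intro ballI)
  fix r assume r: "r \<in> {0..c}"
  let ?F = "at r within {0..c}"
  show "(weighted_symbol k \<beta> t \<longlongrightarrow> weighted_symbol k \<beta> t r) ?F"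
  proof (cases "r = 0")
    case True
    have "(weighted_symbol k \<beta> t \<longlongrightarrow> 0) ?F"
    proof (rule Lim_null_comparison)
      define M where "M = exp (t / 2 * k) * (t / 2) powr (- \<beta>)"
      show "\<forall>\<^sub>F s in ?F. norm (weighted_symbol k \<beta> t s) \<le> M * semigroup_symbol k (t / 2) s"
        unfolding eventually_at_filter
      proof (intro always_eventually allI impI)
        fix s assume "s \<in> {0..c}"
        then have "weighted_symbol k \<beta> (t / 2) s \<le> M"
          using weighted_symbol_le[of "t / 2" s \<beta> k] t \<beta> by (simp add: M_def)
        from mult_right_mono[OF this semigroup_symbol_nonneg[of k "t / 2" s]]
        show "norm (weighted_symbol k \<beta> t s) \<le> M * semigroup_symbol k (t / 2) s"
          by (simp add: weighted_symbol_split[of k \<beta> t] weighted_symbol_nonneg semigroup_symbol_nonneg)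
      qed
      have "continuous_on {0..c} (\<lambda>s. M * semigroup_symbol k (t / 2) s)"
        using t by (intro continuous_intros continuous_on_semigroup_symbol) simp
      then have "((\<lambda>s. M * semigroup_symbol k (t / 2) s) \<longlongrightarrow> M * semigroup_symbol k (t / 2) r) ?F"
        using r unfolding continuous_on_def by blast
      then show "((\<lambda>s. M * semigroup_symbol k (t / 2) s) \<longlongrightarrow> 0) ?F"
        using True by (simp add: semigroup_symbol_def)
    qed
    then show ?thesis using True by (simp add: weighted_symbol_def)
  next
    case False
    then have r0: "0 < r" using r by simp
    have "\<forall>\<^sub>F s in ?F. 0 < s" using r0 by (intro order_tendstoD[OF tendsto_ident_at])
    then have "\<forall>\<^sub>F s in ?F. s powr (- \<beta>) * exp (- (t * (1 / s - k))) = weighted_symbol k \<beta> t s"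
      by eventually_elim (simp add: weighted_symbol_def)
    moreover have "((\<lambda>s. s powr (- \<beta>) * exp (- (t * (1 / s - k)))) \<longlongrightarrow> r powr (- \<beta>) * exp (- (t * (1 / r - k)))) ?F"
      using False by (intro tendsto_intros) auto
    ultimately show ?thesis using False by (simp add: weighted_symbol_def Lim_transform_eventually)
  qed
qed

text \<open>In operator terms, \<open>(exp (- h A) - 1)\<close> composed with
  \<open>B powr (- \<theta>)\<close> is \<open>O(h powr \<theta>)\<close>. Besides the contribution
  of \<open>B\<close>, the shift gives \<open>exp (h * k) - 1 = O(h)\<close>; since
  \<open>h \<le> 1\<close> and \<open>r \<le> c\<close>, \<open>h\<close> is at most
  \<open>c powr \<theta> * (h / r) powr \<theta>\<close>, so this term fits the same bound.\<close>

lemma abs_exp_diff_le: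
  fixes k c r h \<theta> :: real
  assumes k: "0 \<le> k" and r: "0 < r" "r \<le> c" and h: "0 \<le> h" "h \<le> 1" and \<theta>: "0 < \<theta>" "\<theta> \<le> 1"
  shows "\<bar>exp (- (h * (1 / r - k))) - 1\<bar> \<le> exp k * (1 + k * c powr \<theta>) * (h powr \<theta> * r powr (- \<theta>))"
proof -
  define z where "z = h / r"
  have z: "0 \<le> z" using r h by (simp add: z_def)
  have zt: "z powr \<theta> = h powr \<theta> * r powr (- \<theta>)"
    using r h by (simp add: z_def powr_divide powr_minus field_simps)
  have hk: "exp (h * k) \<le> exp k" using h k by (simp add: mult_left_le_one_le)
  have "exp (- (h * (1 / r - k))) - 1 = (exp (h * k) - 1) - exp (h * k) * (1 - exp (- z))"
    by (simp add: z_def algebra_simps exp_add[symmetric])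
  then have "\<bar>exp (- (h * (1 / r - k))) - 1\<bar> \<le> \<bar>exp (h * k) - 1\<bar> + \<bar>exp (h * k) * (1 - exp (- z))\<bar>"
    by (simp only: abs_triangle_ineq4)
  moreover have "\<bar>exp (h * k) * (1 - exp (- z))\<bar> \<le> exp k * z powr \<theta>"
    using hk one_minus_exp_le_powr[OF z, of \<theta>] \<theta> z by (simp add: abs_mult mult_mono)
  moreover have "\<bar>exp (h * k) - 1\<bar> \<le> exp k * (k * c powr \<theta>) * z powr \<theta>"
  proof -
    have "1 - h * k \<le> exp (- (h * k))" using exp_ge_add_one_self[of "- (h * k)"] by simp
    from mult_left_mono[OF this, of "exp (h * k)"] have "exp (h * k) - 1 \<le> exp (h * k) * (h * k)"
      by (simp add: algebra_simps exp_minus)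
    also have "\<dots> \<le> exp k * (h * k)" using hk h k by (intro mult_right_mono) auto
    also have "h \<le> c powr \<theta> * z powr \<theta>"
    proof -
      have "h \<le> h powr \<theta>"
        using h \<theta> by (cases "h = 0") (use powr_mono'[of \<theta> 1 h] in auto)
      also have "\<dots> = r powr \<theta> * z powr \<theta>" using r by (simp add: zt powr_minus)
      also have "\<dots> \<le> c powr \<theta> * z powr \<theta>" using r \<theta> by (intro mult_right_mono powr_mono2) auto
      finally show ?thesis .
    qed
    then have "exp k * (h * k) \<le> exp k * ((c powr \<theta> * z powr \<theta>) * k)"
      using k by (intro mult_left_mono mult_right_mono) auto
    finally show ?thesis using h k by (simp add: ac_simps)
  qed
  ultimately show ?thesis unfolding zt[symmetric] by (simp add: algebra_simps)
qed

text \<open>The gain \<open>h powr \<theta>\<close> costs \<open>\<theta>\<close> further powers of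
  \<open>B\<close>, which the smoothing pays for with
  \<open>t powr (- (\<alpha> + \<theta>))\<close>. This stays integrable at \<open>t = 0\<close>
  when \<open>\<alpha> + \<theta> < 1\<close>.\<close>

lemma abs_semigroup_symbol_diff_le:
  assumes k: "0 \<le> k" and r: "0 \<le> r" "r \<le> c" and h: "0 < h" "h \<le> 1" and t: "0 < t" "t \<le> 1"
    and \<alpha>: "0 \<le> \<alpha>" "0 < \<theta>" "\<alpha> + \<theta> \<le> 1"
  shows "\<bar>(semigroup_symbol k h r - 1) * weighted_symbol k \<alpha> t r\<bar>
           \<le> exp k * (1 + k * c powr \<theta>) * exp k * h powr \<theta> * t powr (- (\<alpha> + \<theta>))"
proof (cases "r = 0")
  case True
  have "0 \<le> exp k * (1 + k * c powr \<theta>) * exp k * h powr \<theta> * t powr (- (\<alpha> + \<theta>))" using k by simp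
  then show ?thesis using True by (simp add: weighted_symbol_def)
next
  case False
  then have r0: "0 < r" using r by simp
  have C0: "0 \<le> exp k * (1 + k * c powr \<theta>)" using k by simp
  have "\<bar>semigroup_symbol k h r - 1\<bar> \<le> exp k * (1 + k * c powr \<theta>) * (h powr \<theta> * r powr (- \<theta>))"
    using abs_exp_diff_le[of k r c h \<theta>] assms r0 by (simp add: semigroup_symbol_def)
  from mult_right_mono[OF this weighted_symbol_nonneg[of k \<alpha> t r]]
  have "\<bar>(semigroup_symbol k h r - 1) * weighted_symbol k \<alpha> t r\<bar>
      \<le> exp k * (1 + k * c powr \<theta>) * (h powr \<theta> * r powr (- \<theta>)) * weighted_symbol k \<alpha> t r"
    by (simp add: abs_mult weighted_symbol_nonneg)
  also have "\<dots> = exp k * (1 + k * c powr \<theta>) * h powr \<theta> * weighted_symbol k (\<alpha> + \<theta>) t r"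
  proof -
    have "r powr (- \<theta>) * r powr (- \<alpha>) = r powr (- (\<alpha> + \<theta>))"
      by (simp add: powr_add[symmetric] add.commute)
    then show ?thesis using False by (simp add: weighted_symbol_def mult.assoc)
  qed
  also have "\<dots> \<le> exp k * (1 + k * c powr \<theta>) * h powr \<theta> * (exp k * t powr (- (\<alpha> + \<theta>)))"
  proof (rule mult_left_mono)
    have "weighted_symbol k (\<alpha> + \<theta>) t r \<le> exp (t * k) * t powr (- (\<alpha> + \<theta>))"
      using assms by (intro weighted_symbol_le) auto
    also have "\<dots> \<le> exp k * t powr (- (\<alpha> + \<theta>))"
      using t k by (intro mult_right_mono) (auto simp: mult_left_le_one_le)
    finally show "weighted_symbol k (\<alpha> + \<theta>) t r \<le> exp k * t powr (- (\<alpha> + \<theta>))" .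
  qed (use C0 in simp)
  finally show ?thesis by (simp add: ac_simps)
qed

text \<open>The case \<open>\<alpha> = 0\<close> is separate because \<open>0 powr 0 = 0\<close>,
  whereas the zeroth power has to be the identity, with a symbol continuous at 0.\<close>

definition power_symbol :: "real \<Rightarrow> real \<Rightarrow> real" where
  "power_symbol \<alpha> r = (if \<alpha> = 0 then 1 else r powr \<alpha>)"

lemma continuous_on_power_symbol:
  assumes "0 \<le> \<alpha>"
  shows "continuous_on {0..c} (power_symbol \<alpha>)"
proof (cases "\<alpha> = 0")
  case False
  then show ?thesis
    unfolding power_symbol_def using assms
    by (simp, intro continuous_on_powr' continuous_on_id continuous_on_const) auto
qed (simp add: power_symbol_def)

lemma power_symbol_mult_weighted_symbol:
  assumes "0 \<le> r"
  shows "power_symbol \<alpha> r * weighted_symbol k \<alpha> t r = semigroup_symbol k t r"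
  using assms by (auto simp: power_symbol_def weighted_symbol_def semigroup_symbol_def powr_minus)

lemma id_mult_weighted_symbol:
  assumes "0 \<le> r"
  shows "r * weighted_symbol k 1 t r = semigroup_symbol k t r"
  using assms by (auto simp: weighted_symbol_def semigroup_symbol_def powr_minus)

context shifted_positive_operator
begin

lemma abs_inner_phi_le:
  assumes f: "continuous_on {0..c} f" and M: "\<And>r. r \<in> {0..c} \<Longrightarrow> \<bar>f r\<bar> \<le> M"
  shows "\<bar>inner (phi f x) y\<bar> \<le> M * norm x * norm y"
  using Cauchy_Schwarz_ineq2[of "phi f x" y] mult_right_mono[OF norm_phi_le[OF f M], of "norm y" x]
  by simp

text \<open>A factor of the symbol is moved to the test vector; the remaining symbol
  \<open>q\<close> may be much larger than \<open>f\<close> near \<open>r = 0\<close>.\<close>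

lemma inner_phi_mult:
  assumes p: "continuous_on {0..c} p" and q: "continuous_on {0..c} q"
    and pq: "\<And>r. r \<in> {0..c} \<Longrightarrow> p r * q r = f r"
  shows "inner (phi f x) y = inner (phi q x) (phi p y)"
proof -
  have "phi f x = phi (\<lambda>r. p r * q r) x" by (rule phi_cong) (simp add: pq)
  also have "\<dots> = phi p (phi q x)" by (rule phi_mult[OF p q])
  finally show ?thesis by (simp add: sym_phi[OF p])
qed

lemma weighted_symbol_bound:
  assumes "0 < t" "t \<le> 1" "0 \<le> \<beta>" "\<beta> \<le> 1" "r \<in> {0..c}"
  shows "\<bar>weighted_symbol k \<beta> t r\<bar> \<le> exp k * t powr (- \<beta>)"
proof -
  have "weighted_symbol k \<beta> t r \<le> exp (t * k) * t powr (- \<beta>)"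
    using assms by (intro weighted_symbol_le) auto
  also have "\<dots> \<le> exp k * t powr (- \<beta>)"
    using assms k_nonneg by (intro mult_right_mono) (auto simp: mult_left_le_one_le)
  finally show ?thesis by (simp add: weighted_symbol_nonneg)
qed

text \<open>This is the identity saying that the integral of \<open>A exp (- (t - s) A) x\<close>
  over \<open>{t - \<tau>..t}\<close> is \<open>x - exp (- \<tau> A) x\<close>, multiplied by
  \<open>R\<close>. The factor \<open>r\<close> turns the unbounded symbol \<open>1 / r - k\<close>
  of \<open>A\<close> into \<open>1 - k * r\<close> and gives continuity up to time zero.\<close>

lemma semigroup_has_integral:
  assumes \<tau>: "0 < \<tau>" "\<tau> \<le> 1"
  shows "((\<lambda>s. phi (\<lambda>r. (1 - k * r) * semigroup_symbol k (t - s) r) x) has_integral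
           (R x - phi (\<lambda>r. r * semigroup_symbol k \<tau> r) x)) {t - \<tau>..t}"
proof -
  define G where "G \<sigma> r = r * exp (- (\<sigma> * (1 / r - k)))" for \<sigma> r :: real
  define H where "H \<sigma> r = (k * r - 1) * semigroup_symbol k \<sigma> r" for \<sigma> r :: real
  have H_cont: "continuous_on ({a..b} \<times> {0..c}) (\<lambda>(\<sigma>, r). H \<sigma> r)" if "0 < a" for a b
  proof -
    have "continuous_on ({a..b} \<times> {0..c}) (\<lambda>(\<sigma>, r). semigroup_symbol k \<sigma> r)"
      by (rule continuous_on_subset[OF continuous_on_semigroup_symbol_pair]) (use that in auto)
    then show ?thesis unfolding H_def case_prod_unfold by (intro continuous_intros)
  qed
  have G_eq: "G \<sigma> r = r * semigroup_symbol k \<sigma> r" for \<sigma> r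
    by (simp add: G_def semigroup_symbol_def)
  have G_0: "G 0 r = r" for r by (simp add: G_def)
  have G_cont: "continuous_on {0..c} (G \<sigma>)" if "0 \<le> \<sigma>" for \<sigma>
  proof (cases "\<sigma> = 0")
    case True
    then show ?thesis by (simp add: G_0[abs_def] continuous_on_id)
  next
    case False
    then show ?thesis
      unfolding G_eq[abs_def] using that by (intro continuous_intros continuous_on_semigroup_symbol) simp
  qed
  have G_der: "((\<lambda>\<sigma>. G \<sigma> r) has_real_derivative H \<sigma> r) (at \<sigma>)" for \<sigma> r
  proof (cases "r = 0")
    case True
    then show ?thesis by (simp add: G_def H_def semigroup_symbol_def)
  next
    case False
    then show ?thesis
      unfolding G_def H_def semigroup_symbol_def
      by (auto intro!: derivative_eq_intros simp: field_simps)
  qed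
  have F_der: "((\<lambda>\<sigma>. phi (G \<sigma>) x) has_vector_derivative phi (H \<sigma>) x) (at \<sigma>)" if "0 < \<sigma>" for \<sigma>
  proof (rule phi_has_vector_derivative[where a = "\<sigma> / 2" and b = "2 * \<sigma>" and G = G and H = H])
    show "continuous_on ({\<sigma> / 2..2 * \<sigma>} \<times> {0..c}) (\<lambda>(t, r). H t r)" by (rule H_cont) (use that in simp)
    show "continuous_on {0..c} (G s)" if "s \<in> {\<sigma> / 2..2 * \<sigma>}" for s
      by (rule G_cont) (use that \<open>0 < \<sigma>\<close> in simp)
    show "\<sigma> \<in> {\<sigma> / 2<..<2 * \<sigma>}" using that by simp
  qed (rule G_der)
  have F_0: "phi (G 0) x = R x"
    using phi_cong[of "G 0" "\<lambda>r. r"] phi_id by (simp add: G_0)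
  \<comment> \<open>At time zero the integrand's symbol is not jointly continuous, so continuity of
    the primitive there comes from the exponential estimate with exponent
    \<open>\<theta> = 1\<close>.\<close>
  have F_near_0: "norm (phi (G \<sigma>) x - R x) \<le> exp k * (1 + k * c) * \<sigma> * norm x" if \<sigma>: "0 \<le> \<sigma>" "\<sigma> \<le> 1" for \<sigma>
  proof -
    have "phi (G \<sigma>) x - R x = phi (\<lambda>r. G \<sigma> r - r) x"
      using phi_diff[OF G_cont[OF \<sigma>(1)] continuous_on_id, of x] phi_id by simp
    also have "norm \<dots> \<le> exp k * (1 + k * c) * \<sigma> * norm x"
    proof (rule norm_phi_le)
      show "continuous_on {0..c} (\<lambda>r. G \<sigma> r - r)"
        by (intro continuous_on_diff G_cont \<sigma> continuous_on_id)
      fix r assume r: "r \<in> {0..c}"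
      show "\<bar>G \<sigma> r - r\<bar> \<le> exp k * (1 + k * c) * \<sigma>"
      proof (cases "r = 0")
        case True
        then show ?thesis using \<sigma> k_nonneg c_pos by (simp add: G_def)
      next
        case False
        then have r0: "0 < r" using r by simp
        have "\<bar>exp (- (\<sigma> * (1 / r - k))) - 1\<bar> \<le> exp k * (1 + k * c powr 1) * (\<sigma> powr 1 * r powr (- 1))"
          using r r0 \<sigma> k_nonneg by (intro abs_exp_diff_le) auto
        also have "\<dots> = exp k * (1 + k * c) * (\<sigma> / r)"
          using r0 c_pos \<sigma> by (simp add: powr_minus divide_inverse)
        finally have "r * \<bar>exp (- (\<sigma> * (1 / r - k))) - 1\<bar> \<le> r * (exp k * (1 + k * c) * (\<sigma> / r))"
          using r0 by (intro mult_left_mono) auto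
        moreover have "\<bar>G \<sigma> r - r\<bar> = r * \<bar>exp (- (\<sigma> * (1 / r - k))) - 1\<bar>"
        proof -
          have "G \<sigma> r - r = r * (exp (- (\<sigma> * (1 / r - k))) - 1)" by (simp add: G_def algebra_simps)
          then show ?thesis using r0 by (simp add: abs_mult)
        qed
        ultimately show ?thesis using r0 by simp
      qed
    qed
    finally show ?thesis .
  qed
  have F_cont: "continuous_on {0..\<tau>} (\<lambda>\<sigma>. phi (G \<sigma>) x)"
  proof (rule continuous_on_eq_continuous_within[THEN iffD2], rule ballI)
    fix \<sigma> assume \<sigma>: "\<sigma> \<in> {0..\<tau>}"
    show "continuous (at \<sigma> within {0..\<tau>}) (\<lambda>\<sigma>. phi (G \<sigma>) x)"
    proof (cases "\<sigma> = 0")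
      case False
      then have "0 < \<sigma>" using \<sigma> by simp
      from has_vector_derivative_continuous[OF F_der[OF this]] show ?thesis
        by (rule continuous_at_imp_continuous_within)
    next
      case True
      have "((\<lambda>\<sigma>. phi (G \<sigma>) x - R x) \<longlongrightarrow> 0) (at 0 within {0..\<tau>})"
      proof (rule Lim_null_comparison)
        show "\<forall>\<^sub>F \<sigma> in at 0 within {0..\<tau>}. norm (phi (G \<sigma>) x - R x) \<le> exp k * (1 + k * c) * \<sigma> * norm x"
          unfolding eventually_at_filter
          by (intro always_eventually allI impI F_near_0) (use \<tau> in auto)
        have "((\<lambda>\<sigma>. exp k * (1 + k * c) * \<sigma> * norm x) \<longlongrightarrow> exp k * (1 + k * c) * 0 * norm x) (at 0 within {0..\<tau>})"
          by (intro tendsto_intros)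
        then show "((\<lambda>\<sigma>. exp k * (1 + k * c) * \<sigma> * norm x) \<longlongrightarrow> 0) (at 0 within {0..\<tau>})" by simp
      qed
      then show ?thesis using True F_0 by (simp add: continuous_within LIM_zero_iff)
    qed
  qed
  have "((\<lambda>s. - phi (H (t - s)) x) has_integral (phi (G (t - t)) x - phi (G (t - (t - \<tau>))) x)) {t - \<tau>..t}"
  proof (rule fundamental_theorem_of_calculus_interior[where f = "\<lambda>s. phi (G (t - s)) x"])
    show "continuous_on {t - \<tau>..t} (\<lambda>s. phi (G (t - s)) x)"
      by (rule continuous_on_compose2[OF F_cont]) (auto intro!: continuous_on_diff continuous_on_const continuous_on_id)
    fix s assume "s \<in> {t - \<tau><..<t}"
    then have "0 < t - s" by simp
    moreover have "((\<lambda>s. t - s) has_vector_derivative - 1) (at s)"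
      by (auto intro!: derivative_eq_intros)
    ultimately show "((\<lambda>s. phi (G (t - s)) x) has_vector_derivative - phi (H (t - s)) x) (at s)"
      using vector_diff_chain_at[of "\<lambda>s. t - s" "- 1" s "\<lambda>\<sigma>. phi (G \<sigma>) x" "phi (H (t - s)) x"] F_der
      by (simp add: o_def)
  qed (use \<tau> in simp)
  moreover have "- phi (H (t - s)) x = phi (\<lambda>r. (1 - k * r) * semigroup_symbol k (t - s) r) x" if "s \<in> {t - \<tau>..t} - {t}" for s
  proof -
    have "continuous_on {0..c} (\<lambda>r. (1 - k * r) * semigroup_symbol k (t - s) r)"
      using that by (intro continuous_intros continuous_on_semigroup_symbol) auto
    from phi_scale[OF this, of "- 1" x] show ?thesis
      using phi_cong[of "H (t - s)" "\<lambda>r. - 1 * ((1 - k * r) * semigroup_symbol k (t - s) r)" x]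
      by (simp add: H_def algebra_simps)
  qed
  ultimately have "((\<lambda>s. phi (\<lambda>r. (1 - k * r) * semigroup_symbol k (t - s) r) x) has_integral
      (phi (G (t - t)) x - phi (G (t - (t - \<tau>))) x)) {t - \<tau>..t}"
    using has_integral_spike_finite[of "{t}" "{t - \<tau>..t}" "\<lambda>s. phi (\<lambda>r. (1 - k * r) * semigroup_symbol k (t - s) r) x"
        "\<lambda>s. - phi (H (t - s)) x"] by simp
  moreover have "phi (G \<tau>) x = phi (\<lambda>r. r * semigroup_symbol k \<tau> r) x"
    by (rule phi_cong) (simp add: G_eq)
  ultimately show ?thesis by (simp add: F_0)
qed

end

subsection \<open>Bounded mild solutions\<close>

locale shifted_self_adjoint_operator = shifted_positive_operator R c D A k
  for R :: "'a::{real_inner,complete_space} \<Rightarrow> 'a" and c :: real and D A k +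
  assumes dense_D: "closure D = UNIV"
    and adjoint_A: "(\<And>x. x \<in> D \<Longrightarrow> inner (A x) y = inner x z) \<Longrightarrow> y \<in> D \<and> A y = z"
begin

text \<open>\<open>R\<close> factors through the power \<open>\<alpha>\<close> because
  \<open>1 - \<alpha>\<close> is positive, so the range contains the domain. Its elements are the
  test vectors on which \<open>B powr \<alpha>\<close> can act.\<close>

lemma dense_range_power_symbol:
  assumes \<alpha>: "0 \<le> \<alpha>" "\<alpha> < 1"
  shows "closure (range (phi (power_symbol \<alpha>))) = UNIV"
proof -
  have "D \<subseteq> range (phi (power_symbol \<alpha>))"
  proof
    fix y assume "y \<in> D"
    define q where "q r = r powr (1 - \<alpha>)" for r :: real
    have q: "continuous_on {0..c} q"
      unfolding q_def using \<alpha> by (intro continuous_on_powr' continuous_on_id continuous_on_const) auto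
    have "R (A y + k *\<^sub>R y) = phi (\<lambda>r. r) (A y + k *\<^sub>R y)" by (simp add: phi_id)
    also have "\<dots> = phi (\<lambda>r. power_symbol \<alpha> r * q r) (A y + k *\<^sub>R y)"
      by (rule phi_cong) (auto simp: power_symbol_def q_def powr_add[symmetric])
    also have "\<dots> = phi (power_symbol \<alpha>) (phi q (A y + k *\<^sub>R y))"
      by (intro phi_mult continuous_on_power_symbol q \<alpha>)
    finally show "y \<in> range (phi (power_symbol \<alpha>))" using R_A[OF \<open>y \<in> D\<close>] by (metis rangeI)
  qed
  then show ?thesis using closure_mono dense_D by blast
qed

text \<open>\<open>u\<close> is a solution on the whole line with \<open>f = g \<circ> u\<close> and \<open>w\<close> the fractional power of \<open>u\<close>;
  \<open>\<kappa>\<close> is the normalisation of Balakrishnan's integral.\<close>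

definition mild :: "real \<Rightarrow> real \<Rightarrow> real \<Rightarrow> real \<Rightarrow> real \<Rightarrow> (real \<Rightarrow> 'a) \<Rightarrow> (real \<Rightarrow> 'a) \<Rightarrow> (real \<Rightarrow> 'a) \<Rightarrow> bool" where
  "mild \<alpha> \<kappa> M N L u w f \<longleftrightarrow>
     (\<forall>t. u t = \<kappa> *\<^sub>R phi (power_symbol \<alpha>) (w t)) \<and>
     (\<forall>t0 t. t0 \<le> t \<longrightarrow> ((\<lambda>s. op_semigroup D A (t - s) (f s)) has_integral
         (u t - op_semigroup D A (t - t0) (u t0))) {t0..t}) \<and>
     (\<forall>s. norm (f s) \<le> M) \<and> (\<forall>s. norm (u s) \<le> N) \<and>
     (\<forall>s t. norm (f s - f t) \<le> L * norm (w s - w t))"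

lemma mildD:
  assumes "mild \<alpha> \<kappa> M N L u w f"
  shows "u t = \<kappa> *\<^sub>R phi (power_symbol \<alpha>) (w t)"
    and "t0 \<le> t \<Longrightarrow> ((\<lambda>s. op_semigroup D A (t - s) (f s)) has_integral
         (u t - op_semigroup D A (t - t0) (u t0))) {t0..t}"
    and "norm (f s) \<le> M" and "norm (u s) \<le> N" and "norm (f s - f t) \<le> L * norm (w s - w t)"
  using assms unfolding mild_def by blast+

text \<open>The increment is the integral over \<open>{t..t + h}\<close> plus
  \<open>(exp (- h A) - 1) (u t)\<close>. Since \<open>u t\<close> itself has no regularity to
  spare, it is expanded once more by the variation of constants formula over the unit interval
  before \<open>t\<close>, where the semigroup smooths. This use of the past keeps the constant
  independent of the solution.\<close>

lemma mild_holder: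
  assumes \<alpha>: "0 \<le> \<alpha>" "\<alpha> < 1" and \<theta>: "0 < \<theta>" "\<alpha> + \<theta> < 1" and \<kappa>: "\<kappa> \<noteq> 0" and MN: "0 \<le> M" "0 \<le> N"
  obtains C where "0 \<le> C" "\<And>u w f t h. mild \<alpha> \<kappa> M N L u w f \<Longrightarrow> 0 < h \<Longrightarrow> h \<le> 1 \<Longrightarrow>
      norm (w (t + h) - w t) \<le> C * h powr \<theta>"
proof -
  define C1 where "C1 = exp k * (1 + k * c powr \<theta>) * exp k"
  \<comment> \<open>The three terms come from the new piece \<open>{t..t + h}\<close>, the unit
    interval of history, and the value at its left end \<open>t - 1\<close>; division by the
    absolute value of \<open>\<kappa>\<close> passes from \<open>u\<close> to
    \<open>w\<close>.\<close>
  define C where "C = (exp k * M / (1 - \<alpha>) + C1 * M / (1 - (\<alpha> + \<theta>)) + C1 * N) / \<bar>\<kappa>\<bar>"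
  have C1: "0 \<le> C1" using k_nonneg by (simp add: C1_def)
  have C: "0 \<le> C" using C1 MN \<alpha> \<theta> by (simp add: C_def)
  let ?p = "power_symbol \<alpha>"
  have p: "continuous_on {0..c} ?p" by (rule continuous_on_power_symbol[OF \<alpha>(1)])
  have "norm (w (t + h) - w t) \<le> C * h powr \<theta>"
    if mild: "mild \<alpha> \<kappa> M N L u w f" and h: "0 < h" "h \<le> 1" for u w f t h
  proof (rule norm_le_if_inner_le_dense[OF dense_range_power_symbol[OF \<alpha>]])
    show "0 \<le> C * h powr \<theta>" using C by simp
    note uw = mildD(1)[OF mild] and voc = mildD(2)[OF mild] and fM = mildD(3)[OF mild] and uN = mildD(4)[OF mild]
    fix v assume "v \<in> range (phi ?p)"
    then obtain y where v: "v = phi ?p y" by auto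
    define eh where "eh r = semigroup_symbol k h r - 1" for r
    have eh: "continuous_on {0..c} eh"
      unfolding eh_def by (intro continuous_intros continuous_on_semigroup_symbol h)
    define \<psi> where "\<psi> z = inner (phi eh z) y" for z
    have \<psi>: "bounded_linear \<psi>"
      unfolding \<psi>_def by (intro bounded_linear_compose[OF bounded_linear_inner_left bounded_linear_phi] eh)
    \<comment> \<open>The bound is in terms of \<open>norm v\<close>, although \<open>y\<close> may
      be much larger than \<open>v\<close>: the semigroup supplies the weight of order
      \<open>\<alpha>\<close> that converts \<open>y\<close> into \<open>v\<close>.\<close>
    have \<psi>_le: "\<bar>\<psi> (op_semigroup D A \<sigma> z)\<bar> \<le> C1 * h powr \<theta> * Z * norm v * \<sigma> powr (- (\<alpha> + \<theta>))"
      if \<sigma>: "0 < \<sigma>" "\<sigma> \<le> 1" and z: "norm z \<le> Z" for \<sigma> z Z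
    proof -
      have ws: "continuous_on {0..c} (weighted_symbol k \<alpha> \<sigma>)"
        using \<alpha> \<sigma> by (intro continuous_on_weighted_symbol) auto
      have es: "continuous_on {0..c} (semigroup_symbol k \<sigma>)" by (rule continuous_on_semigroup_symbol[OF \<sigma>(1)])
      have ew: "continuous_on {0..c} (\<lambda>r. eh r * weighted_symbol k \<alpha> \<sigma> r)"
        by (intro continuous_on_mult eh ws)
      have "\<psi> (op_semigroup D A \<sigma> z) = inner (phi (\<lambda>r. eh r * semigroup_symbol k \<sigma> r) z) y"
        by (simp add: \<psi>_def op_semigroup_eq_phi[OF \<sigma>(1)] phi_mult[OF eh es])
      also have "\<dots> = inner (phi (\<lambda>r. eh r * weighted_symbol k \<alpha> \<sigma> r) z) v"
        unfolding v
      proof (rule inner_phi_mult[OF p ew])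
        fix r assume "r \<in> {0..c}"
        then have "?p r * weighted_symbol k \<alpha> \<sigma> r = semigroup_symbol k \<sigma> r"
          by (intro power_symbol_mult_weighted_symbol) simp
        then show "?p r * (eh r * weighted_symbol k \<alpha> \<sigma> r) = eh r * semigroup_symbol k \<sigma> r"
          by (metis mult.left_commute)
      qed
      also have "\<bar>\<dots>\<bar> \<le> (C1 * h powr \<theta> * \<sigma> powr (- (\<alpha> + \<theta>))) * norm z * norm v"
        unfolding C1_def eh_def
        by (intro abs_inner_phi_le ew[unfolded eh_def] abs_semigroup_symbol_diff_le) (use k_nonneg h \<sigma> \<alpha> \<theta> in auto)
      also have "\<dots> \<le> (C1 * h powr \<theta> * \<sigma> powr (- (\<alpha> + \<theta>))) * Z * norm v"
        using C1 z by (intro mult_right_mono mult_left_mono) auto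
      finally show ?thesis by (simp add: ac_simps)
    qed
    have 1: "\<bar>inner (u (t + h) - op_semigroup D A h (u t)) y\<bar>
        \<le> (exp k * M * norm v) * (h powr (1 - \<alpha>) / (1 - \<alpha>))"
    proof (rule abs_integral_le_powr)
      show "((\<lambda>s. inner (op_semigroup D A (t + h - s) (f s)) y) has_integral
          inner (u (t + h) - op_semigroup D A h (u t)) y) {(t + h) - h..t + h}"
        using has_integral_linear[OF voc[of t "t + h"] bounded_linear_inner_left[of y]] h by (simp add: o_def)
      fix s assume s: "t + h - h \<le> s" "s < t + h"
      then have \<sigma>: "0 < t + h - s" "t + h - s \<le> 1" using h by auto
      have ws: "continuous_on {0..c} (weighted_symbol k \<alpha> (t + h - s))"
        using \<alpha> \<sigma> by (intro continuous_on_weighted_symbol) auto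
      have "inner (op_semigroup D A (t + h - s) (f s)) y = inner (phi (weighted_symbol k \<alpha> (t + h - s)) (f s)) v"
        unfolding op_semigroup_eq_phi[OF \<sigma>(1)] v
        by (rule inner_phi_mult[OF p ws power_symbol_mult_weighted_symbol]) simp
      also have "\<bar>\<dots>\<bar> \<le> (exp k * (t + h - s) powr (- \<alpha>)) * norm (f s) * norm v"
        by (intro abs_inner_phi_le ws weighted_symbol_bound \<sigma> \<alpha>) (use \<alpha> in auto)
      also have "\<dots> \<le> (exp k * (t + h - s) powr (- \<alpha>)) * M * norm v"
        using fM by (intro mult_right_mono mult_left_mono) auto
      finally show "\<bar>inner (op_semigroup D A (t + h - s) (f s)) y\<bar> \<le> exp k * M * norm v * (t + h - s) powr (- \<alpha>)"
        by (simp add: ac_simps)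
    qed (use h \<alpha> in auto)
    have 2: "\<bar>\<psi> (u t) - \<psi> (op_semigroup D A 1 (u (t - 1)))\<bar>
        \<le> (C1 * h powr \<theta> * M * norm v) * (1 powr (1 - (\<alpha> + \<theta>)) / (1 - (\<alpha> + \<theta>)))"
    proof (rule abs_integral_le_powr)
      show "((\<lambda>s. \<psi> (op_semigroup D A (t - s) (f s))) has_integral
          \<psi> (u t) - \<psi> (op_semigroup D A 1 (u (t - 1)))) {t - 1..t}"
        using has_integral_linear[OF voc[of "t - 1" t] \<psi>] by (simp add: o_def linear_diff[OF bounded_linear.linear[OF \<psi>]])
      show "\<bar>\<psi> (op_semigroup D A (t - s) (f s))\<bar> \<le> C1 * h powr \<theta> * M * norm v * (t - s) powr (- (\<alpha> + \<theta>))"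
        if "t - 1 \<le> s" "s < t" for s
        by (rule \<psi>_le) (use that fM in auto)
    qed (use \<theta> in auto)
    have 3: "\<bar>\<psi> (op_semigroup D A 1 (u (t - 1)))\<bar> \<le> C1 * h powr \<theta> * N * norm v"
      using \<psi>_le[of 1 "u (t - 1)" N] uN by simp
    have "op_semigroup D A h (u t) - u t = phi eh (u t)"
      unfolding op_semigroup_eq_phi[OF h(1)] eh_def
      using phi_diff[OF continuous_on_semigroup_symbol[OF h(1), where k = k] continuous_on_const[of "{0..c}" "1::real"], of "u t"]
      by (simp add: phi_1)
    then have "u (t + h) - u t = (u (t + h) - op_semigroup D A h (u t)) + phi eh (u t)" by (simp add: algebra_simps)
    then have split: "inner (u (t + h) - u t) y = inner (u (t + h) - op_semigroup D A h (u t)) y + \<psi> (u t)"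
      unfolding \<psi>_def by (metis inner_add_left)
    have "h powr (1 - \<alpha>) \<le> h powr \<theta>" using h \<theta> by (intro powr_mono') auto
    then have "(exp k * M * norm v) * (h powr (1 - \<alpha>) / (1 - \<alpha>)) \<le> (exp k * M * norm v) * (h powr \<theta> / (1 - \<alpha>))"
      using MN \<alpha> by (intro mult_left_mono divide_right_mono) auto
    with 1 2 3 have "\<bar>inner (u (t + h) - u t) y\<bar> \<le> (exp k * M * norm v) * (h powr \<theta> / (1 - \<alpha>))
        + (C1 * h powr \<theta> * M * norm v) * (1 / (1 - (\<alpha> + \<theta>))) + C1 * h powr \<theta> * N * norm v"
      unfolding split by (simp add: abs_le_iff)
    also have "\<dots> = (\<bar>\<kappa>\<bar> * C) * (h powr \<theta> * norm v)"
    proof -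
      have "\<bar>\<kappa>\<bar> * C = exp k * M / (1 - \<alpha>) + C1 * M / (1 - (\<alpha> + \<theta>)) + C1 * N" using \<kappa> by (simp add: C_def)
      then show ?thesis by (simp only:) (simp add: algebra_simps)
    qed
    also have "\<dots> = \<bar>\<kappa>\<bar> * (C * h powr \<theta> * norm v)" by (simp only: mult.assoc)
    finally have "\<bar>inner (u (t + h) - u t) y\<bar> \<le> \<bar>\<kappa>\<bar> * (C * h powr \<theta> * norm v)" .
    moreover have "inner (u (t + h) - u t) y = \<kappa> * inner (w (t + h) - w t) v"
      by (simp add: uw v sym_phi[OF p] inner_diff_left right_diff_distrib)
    ultimately have "\<bar>\<kappa>\<bar> * \<bar>inner (w (t + h) - w t) v\<bar> \<le> \<bar>\<kappa>\<bar> * (C * h powr \<theta> * norm v)"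
      by (simp add: abs_mult)
    then show "inner (w (t + h) - w t) v \<le> C * h powr \<theta> * norm v" using \<kappa> by simp
  qed
  with C that show thesis by blast
qed

lemma mild_weak_estimate:
  assumes \<alpha>: "0 \<le> \<alpha>" "\<alpha> < 1" and \<theta>: "0 < \<theta>" "\<alpha> + \<theta> < 1" and \<kappa>: "\<kappa> \<noteq> 0" and MN: "0 \<le> M" "0 \<le> N" and L: "0 \<le> L"
  obtains C where "0 \<le> C" "\<And>u w f t \<tau> y. mild \<alpha> \<kappa> M N L u w f \<Longrightarrow> 0 < \<tau> \<Longrightarrow> \<tau> \<le> 1 \<Longrightarrow> y \<in> D \<Longrightarrow>
      \<bar>inner (u t) (A y + k *\<^sub>R y) - inner (phi (weighted_symbol k 1 \<tau>) (u (t - \<tau>))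
         + (f t - phi (semigroup_symbol k \<tau>) (f t))) y\<bar> \<le> C * \<tau> powr \<theta> * norm y"
proof -
  obtain Ch where Ch: "0 \<le> Ch" "\<And>u w f t h. mild \<alpha> \<kappa> M N L u w f \<Longrightarrow> 0 < h \<Longrightarrow> h \<le> 1 \<Longrightarrow>
      norm (w (t + h) - w t) \<le> Ch * h powr \<theta>"
    using mild_holder[OF \<alpha> \<theta> \<kappa> MN, of L] by metis
  \<comment> \<open>The denominator is the integral of \<open>\<sigma> powr (\<theta> - 1)\<close>;
    the second summand is the price of the shift by \<open>k\<close>.\<close>
  define C where "C = (exp k * L * Ch + k * exp k * M) / \<theta>"
  have "0 \<le> C" using Ch L MN k_nonneg \<theta> by (simp add: C_def)
  moreover have "\<bar>inner (u t) (A y + k *\<^sub>R y) - inner (phi (weighted_symbol k 1 \<tau>) (u (t - \<tau>))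
         + (f t - phi (semigroup_symbol k \<tau>) (f t))) y\<bar> \<le> C * \<tau> powr \<theta> * norm y"
    if mild: "mild \<alpha> \<kappa> M N L u w f" and \<tau>: "0 < \<tau>" "\<tau> \<le> 1" and y: "y \<in> D" for u w f t \<tau> y
  proof -
    note fM = mildD(3)[OF mild] and fL = mildD(5)[OF mild]
    have voc: "((\<lambda>s. op_semigroup D A (t - s) (f s)) has_integral
         (u t - op_semigroup D A \<tau> (u (t - \<tau>)))) {t - \<tau>..t}"
      using mildD(2)[OF mild, of "t - \<tau>" t] \<tau> by simp
    define v where "v = A y + k *\<^sub>R y"
    have Rv: "R v = y" using R_A[OF y] by (simp add: v_def)
    have id: "continuous_on {0..c} (\<lambda>r. r)" by (rule continuous_on_id)
    have shift: "inner (phi (semigroup_symbol k \<sigma>) z) v = inner (phi (weighted_symbol k 1 \<sigma>) z) y" if "0 < \<sigma>" for \<sigma> z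
      using inner_phi_mult[OF id continuous_on_weighted_symbol[OF that] id_mult_weighted_symbol[where k = k], of z v]
      by (simp add: phi_id Rv)
    have shift': "inner (phi (\<lambda>r. r * semigroup_symbol k \<sigma> r) z) v = inner (phi (semigroup_symbol k \<sigma>) z) y" if "0 < \<sigma>" for \<sigma> z
      using inner_phi_mult[OF id continuous_on_semigroup_symbol[OF that, where k = k] refl, of z v]
      by (simp add: phi_id Rv)
    define F where "F s = inner (op_semigroup D A (t - s) (f s)) v
        - inner (phi (\<lambda>r. (1 - k * r) * semigroup_symbol k (t - s) r) (f t)) v" for s
    have F: "(F has_integral inner (u t - op_semigroup D A \<tau> (u (t - \<tau>))) v
        - inner (R (f t) - phi (\<lambda>r. r * semigroup_symbol k \<tau> r) (f t)) v) {t - \<tau>..t}"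
      unfolding F_def
      using has_integral_diff[OF has_integral_linear[OF voc bounded_linear_inner_left[of v]]
          has_integral_linear[OF semigroup_has_integral[OF \<tau>] bounded_linear_inner_left[of v]]]
      by (simp add: o_def)
    have "inner (R (f t)) v = inner (f t) y" by (simp add: sym_R Rv)
    then have val: "inner (u t - op_semigroup D A \<tau> (u (t - \<tau>))) v
        - inner (R (f t) - phi (\<lambda>r. r * semigroup_symbol k \<tau> r) (f t)) v
        = inner (u t) v - inner (phi (weighted_symbol k 1 \<tau>) (u (t - \<tau>)) + (f t - phi (semigroup_symbol k \<tau>) (f t))) y"
      by (simp add: op_semigroup_eq_phi[OF \<tau>(1)] inner_diff_left inner_add_left shift[OF \<tau>(1)] shift'[OF \<tau>(1)])
    have "\<bar>inner (u t) v - inner (phi (weighted_symbol k 1 \<tau>) (u (t - \<tau>)) + (f t - phi (semigroup_symbol k \<tau>) (f t))) y\<bar>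
        \<le> ((exp k * L * Ch + k * exp k * M) * norm y) * (\<tau> powr (1 - (1 - \<theta>)) / (1 - (1 - \<theta>)))"
    proof (rule abs_integral_le_powr[OF F[unfolded val]])
      fix s assume s: "t - \<tau> \<le> s" "s < t"
      define \<sigma> where "\<sigma> = t - s"
      have \<sigma>: "0 < \<sigma>" "\<sigma> \<le> 1" using s \<tau> by (auto simp: \<sigma>_def)
      have es: "continuous_on {0..c} (semigroup_symbol k \<sigma>)" by (rule continuous_on_semigroup_symbol[OF \<sigma>(1)])
      have ws: "continuous_on {0..c} (weighted_symbol k 1 \<sigma>)" by (rule continuous_on_weighted_symbol[OF \<sigma>(1)]) auto
      have res: "continuous_on {0..c} (\<lambda>r. r * semigroup_symbol k \<sigma> r)" by (intro continuous_on_mult id es)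
      have "phi (\<lambda>r. (1 - k * r) * semigroup_symbol k \<sigma> r) (f t)
          = phi (\<lambda>r. semigroup_symbol k \<sigma> r - k * (r * semigroup_symbol k \<sigma> r)) (f t)"
        by (rule phi_cong) (simp add: algebra_simps)
      also have "\<dots> = phi (semigroup_symbol k \<sigma>) (f t) - k *\<^sub>R phi (\<lambda>r. r * semigroup_symbol k \<sigma> r) (f t)"
        using phi_diff[OF es continuous_on_mult_left[OF res, of k], of "f t"] phi_scale[OF res, of k "f t"] by simp
      finally have "F s = inner (phi (semigroup_symbol k \<sigma>) (f s) - phi (semigroup_symbol k \<sigma>) (f t)) v
          + k * inner (phi (\<lambda>r. r * semigroup_symbol k \<sigma> r) (f t)) v"
        unfolding F_def \<sigma>_def[symmetric] op_semigroup_eq_phi[OF \<sigma>(1)]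
        by (simp add: inner_diff_left)
      also have "phi (semigroup_symbol k \<sigma>) (f s) - phi (semigroup_symbol k \<sigma>) (f t) = phi (semigroup_symbol k \<sigma>) (f s - f t)"
        by (simp add: linear_diff[OF linear_phi[OF es]])
      finally have Fs: "F s = inner (phi (weighted_symbol k 1 \<sigma>) (f s - f t)) y + k * inner (phi (semigroup_symbol k \<sigma>) (f t)) y"
        by (simp add: shift[OF \<sigma>(1)] shift'[OF \<sigma>(1)])
      have "norm (w t - w s) \<le> Ch * \<sigma> powr \<theta>"
        using Ch(2)[OF mild \<sigma>, of s] by (simp add: \<sigma>_def)
      then have "L * norm (w s - w t) \<le> L * (Ch * \<sigma> powr \<theta>)"
        using L by (intro mult_left_mono) (auto simp: norm_minus_commute)
      then have fst: "norm (f s - f t) \<le> L * (Ch * \<sigma> powr \<theta>)" using fL[of s t] by linarith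
      have "\<bar>inner (phi (weighted_symbol k 1 \<sigma>) (f s - f t)) y\<bar> \<le> (exp k * \<sigma> powr (- 1)) * norm (f s - f t) * norm y"
        by (intro abs_inner_phi_le ws weighted_symbol_bound \<sigma>) auto
      also have "\<dots> \<le> (exp k * \<sigma> powr (- 1)) * (L * (Ch * \<sigma> powr \<theta>)) * norm y"
        using fst by (intro mult_right_mono mult_left_mono) auto
      also have "\<dots> = exp k * L * Ch * norm y * (\<sigma> powr (- 1) * \<sigma> powr \<theta>)" by simp
      also have "\<sigma> powr (- 1) * \<sigma> powr \<theta> = \<sigma> powr (- (1 - \<theta>))"
        unfolding powr_add[symmetric] by simp
      finally have b1: "\<bar>inner (phi (weighted_symbol k 1 \<sigma>) (f s - f t)) y\<bar> \<le> exp k * L * Ch * norm y * \<sigma> powr (- (1 - \<theta>))" .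
      have "\<bar>semigroup_symbol k \<sigma> r\<bar> \<le> exp k" if "r \<in> {0..c}" for r
      proof (cases "r = 0")
        case False
        then have "0 < r" using that by simp
        then have "- (\<sigma> * (1 / r - k)) \<le> \<sigma> * k" using \<sigma> by (simp add: algebra_simps)
        also have "\<dots> \<le> k" using \<sigma> k_nonneg by (simp add: mult_left_le_one_le)
        finally show ?thesis using False by (simp add: semigroup_symbol_def)
      qed (simp add: semigroup_symbol_def)
      then have "\<bar>inner (phi (semigroup_symbol k \<sigma>) (f t)) y\<bar> \<le> exp k * norm (f t) * norm y"
        by (intro abs_inner_phi_le es)
      also have "\<dots> \<le> exp k * M * norm y * 1" using fM by (simp add: mult_right_mono)
      also have "\<dots> \<le> exp k * M * norm y * \<sigma> powr (- (1 - \<theta>))"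
      proof (rule mult_left_mono)
        have "\<sigma> powr (1 - \<theta>) \<le> 1" using \<sigma> \<theta> \<alpha> by (intro powr_le1) auto
        then show "1 \<le> \<sigma> powr (- (1 - \<theta>))" using \<sigma> unfolding powr_minus by (intro one_le_inverse) auto
      qed (use MN in simp)
      finally have b2: "k * \<bar>inner (phi (semigroup_symbol k \<sigma>) (f t)) y\<bar> \<le> k * (exp k * M * norm y * \<sigma> powr (- (1 - \<theta>)))"
        using k_nonneg by (intro mult_left_mono)
      have "\<bar>F s\<bar> \<le> \<bar>inner (phi (weighted_symbol k 1 \<sigma>) (f s - f t)) y\<bar> + k * \<bar>inner (phi (semigroup_symbol k \<sigma>) (f t)) y\<bar>"
        unfolding Fs using abs_triangle_ineq[of "inner (phi (weighted_symbol k 1 \<sigma>) (f s - f t)) y"] k_nonneg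
        by (metis abs_mult abs_of_nonneg)
      with b1 b2 show "\<bar>F s\<bar> \<le> (exp k * L * Ch + k * exp k * M) * norm y * (t - s) powr (- (1 - \<theta>))"
        unfolding \<sigma>_def[symmetric] by (simp add: algebra_simps)
    qed (use \<tau> \<theta> in auto)
    then show ?thesis by (simp add: v_def C_def ac_simps)
  qed
  ultimately show thesis using that by blast
qed

text \<open>As \<open>\<tau>\<close> tends to 0 the approximants converge to a vector representing
  the functional \<open>y \<mapsto> inner (u t) (B y)\<close> on the domain. Self-adjointness then
  puts \<open>u t\<close> into the domain and identifies the limit with
  \<open>B (u t)\<close>.\<close>

lemma mild_in_domain:
  assumes \<alpha>: "0 \<le> \<alpha>" "\<alpha> < 1" and \<kappa>: "\<kappa> \<noteq> 0" and MN: "0 \<le> M" "0 \<le> N" and L: "0 \<le> L"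
  shows "\<exists>C \<theta>. 0 < \<theta> \<and> 0 \<le> C \<and> (\<forall>u w f t. mild \<alpha> \<kappa> M N L u w f \<longrightarrow> u t \<in> D \<and>
      (\<forall>\<tau>. 0 < \<tau> \<longrightarrow> \<tau> \<le> 1 \<longrightarrow>
        norm (A (u t) + k *\<^sub>R u t - (phi (weighted_symbol k 1 \<tau>) (u (t - \<tau>))
           + (f t - phi (semigroup_symbol k \<tau>) (f t)))) \<le> C * \<tau> powr \<theta>))"
proof -
  \<comment> \<open>Any exponent strictly between 0 and \<open>1 - \<alpha>\<close> would serve;
    this is the midpoint.\<close>
  define \<theta> where "\<theta> = (1 - \<alpha>) / 2"
  have \<theta>: "0 < \<theta>" "\<alpha> + \<theta> < 1" using \<alpha> by (auto simp: \<theta>_def field_simps)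
  define z where "z u f t \<tau> = phi (weighted_symbol k 1 \<tau>) (u (t - \<tau>)) + (f t - phi (semigroup_symbol k \<tau>) (f t))"
    for u f :: "real \<Rightarrow> 'a" and t \<tau>
  obtain C where C: "0 \<le> C" "\<And>u w f t \<tau> y. mild \<alpha> \<kappa> M N L u w f \<Longrightarrow> 0 < \<tau> \<Longrightarrow> \<tau> \<le> 1 \<Longrightarrow> y \<in> D \<Longrightarrow>
      \<bar>inner (u t) (A y + k *\<^sub>R y) - inner (z u f t \<tau>) y\<bar> \<le> C * \<tau> powr \<theta> * norm y"
    using mild_weak_estimate[OF \<alpha> \<theta> \<kappa> MN L] unfolding z_def by metis
  have main: "u t \<in> D \<and> (\<forall>\<tau>. 0 < \<tau> \<longrightarrow> \<tau> \<le> 1 \<longrightarrow> norm (A (u t) + k *\<^sub>R u t - z u f t \<tau>) \<le> C * \<tau> powr \<theta>)"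
    if mild: "mild \<alpha> \<kappa> M N L u w f" for u w f t
  proof -
    \<comment> \<open>Both vectors approximate the same functional on the dense domain, so their
      distance is at most the sum of the two errors.\<close>
    have cau: "norm (z u f t \<sigma> - z u f t \<tau>) \<le> C * \<sigma> powr \<theta> + C * \<tau> powr \<theta>"
      if "0 < \<sigma>" "\<sigma> \<le> 1" "0 < \<tau>" "\<tau> \<le> 1" for \<sigma> \<tau>
    proof (rule norm_le_if_inner_le_dense[OF dense_D])
      fix y assume "y \<in> D"
      with C(2)[OF mild that(1,2), of y t] C(2)[OF mild that(3,4), of y t]
      show "inner (z u f t \<sigma> - z u f t \<tau>) y \<le> (C * \<sigma> powr \<theta> + C * \<tau> powr \<theta>) * norm y"
        by (simp add: inner_diff_left distrib_right abs_le_iff)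
    qed (use C in simp)
    define T where "T n = inverse (real (Suc n))" for n
    have T: "0 < T n" "T n \<le> 1" for n by (auto simp: T_def inverse_le_1_iff)
    have "T \<longlonglongrightarrow> 0" unfolding T_def by (rule LIMSEQ_inverse_real_of_nat)
    then have "(\<lambda>n. T n powr \<theta>) \<longlonglongrightarrow> 0 powr \<theta>"
      using \<theta> T by (intro tendsto_powr2 tendsto_const) (auto intro!: always_eventually less_imp_le)
    then have lim: "(\<lambda>n. C * T n powr \<theta>) \<longlonglongrightarrow> 0" by (intro tendsto_mult_right_zero) simp
    have "Cauchy (\<lambda>n. z u f t (T n))"
    proof (rule CauchyI)
      fix e :: real assume "0 < e"
      then have "\<forall>\<^sub>F n in sequentially. C * T n powr \<theta> < e / 2" using lim by (intro order_tendstoD) auto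
      then obtain n0 where n0: "\<And>n. n0 \<le> n \<Longrightarrow> C * T n powr \<theta> < e / 2" by (auto simp: eventually_sequentially)
      show "\<exists>M. \<forall>m\<ge>M. \<forall>n\<ge>M. norm (z u f t (T m) - z u f t (T n)) < e"
      proof (intro exI allI impI)
        fix m n assume "n0 \<le> m" "n0 \<le> n"
        with cau[OF T[of m] T[of n]] n0[of m] n0[of n] show "norm (z u f t (T m) - z u f t (T n)) < e" by linarith
      qed
    qed
    then obtain zz where zz: "(\<lambda>n. z u f t (T n)) \<longlonglongrightarrow> zz"
      by (auto simp: Cauchy_convergent_iff convergent_def)
    have eq: "inner (u t) (A y + k *\<^sub>R y) = inner zz y" if y: "y \<in> D" for y
    proof -
      have "(\<lambda>n. \<bar>inner (u t) (A y + k *\<^sub>R y) - inner (z u f t (T n)) y\<bar>) \<longlonglongrightarrow> \<bar>inner (u t) (A y + k *\<^sub>R y) - inner zz y\<bar>"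
        by (intro tendsto_intros zz)
      moreover have "(\<lambda>n. C * T n powr \<theta> * norm y) \<longlonglongrightarrow> 0" by (intro tendsto_mult_left_zero lim)
      ultimately have "\<bar>inner (u t) (A y + k *\<^sub>R y) - inner zz y\<bar> \<le> 0"
        by (rule LIMSEQ_le) (use C(2)[OF mild T y] in blast)
      then show ?thesis by simp
    qed
    have "u t \<in> D \<and> A (u t) = zz - k *\<^sub>R u t"
    proof (rule adjoint_A)
      fix y assume "y \<in> D"
      from eq[OF this] show "inner (A y) (u t) = inner y (zz - k *\<^sub>R u t)"
        by (simp add: inner_add_right inner_diff_right inner_commute)
    qed
    moreover have "norm (zz - z u f t \<tau>) \<le> C * \<tau> powr \<theta>" if "0 < \<tau>" "\<tau> \<le> 1" for \<tau>
    proof (rule norm_le_if_inner_le_dense[OF dense_D])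
      fix y assume "y \<in> D"
      with C(2)[OF mild that, of y t] eq[of y]
      show "inner (zz - z u f t \<tau>) y \<le> C * \<tau> powr \<theta> * norm y"
        by (simp add: inner_diff_left abs_le_iff)
    qed (use C in simp)
    ultimately show ?thesis by simp
  qed
  show ?thesis
    by (intro exI[of _ C] exI[of _ \<theta>] conjI \<theta>(1) C(1) allI impI main[unfolded z_def])
qed

end

section \<open>From the spectral hypothesis to a bounded positive inverse\<close>

lemma inv_into_symmetric:
  fixes T :: "'a::real_inner \<Rightarrow> 'a"
  assumes bij: "bij_betw T D UNIV"
    and sym: "\<forall>x\<in>D. \<forall>y\<in>D. inner (T x) y = inner x (T y)"
  shows "inv_into D T y \<in> D" "T (inv_into D T y) = y" "x \<in> D \<Longrightarrow> inv_into D T (T x) = x"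
    "inner (inv_into D T a) b = inner a (inv_into D T b)"
proof -
  have surj: "T ` D = UNIV" using bij by (simp add: bij_betw_def)
  show in_D: "inv_into D T y \<in> D" for y using surj by (simp add: inv_into_into)
  show T_inv: "T (inv_into D T y) = y" for y using surj by (simp add: f_inv_into_f)
  show "inv_into D T (T x) = x" if "x \<in> D" using bij that by (simp add: bij_betw_def inv_into_f_f)
  show "inner (inv_into D T a) b = inner a (inv_into D T b)"
    using sym in_D T_inv by metis
qed

text \<open>Let \<open>m\<close> be the best lower bound of the form. If \<open>m\<close> were
  negative it would lie in the resolvent set, and the bounded positive inverse of
  \<open>B - m\<close> would force \<open>B - m \<ge> 1 / C\<close>, against the maximality of
  \<open>m\<close>.\<close>

lemma form_nonneg_if_spectrum_pos:
  fixes B :: "'a::real_inner \<Rightarrow> 'a"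
  assumes sym: "\<forall>x\<in>D. \<forall>y\<in>D. inner (B x) y = inner x (B y)"
    and below: "\<And>x. x \<in> D \<Longrightarrow> b * (norm x)\<^sup>2 \<le> inner (B x) x"
    and spec: "\<forall>l\<in>op_spectrum D B. 0 < l"
    and x0: "x0 \<in> D"
  shows "0 \<le> inner (B x0) x0"
proof (rule ccontr)
  assume neg: "\<not> 0 \<le> inner (B x0) x0"
  then have n0: "0 < (norm x0)\<^sup>2" by auto
  define S where "S = {l. \<forall>x\<in>D. l * (norm x)\<^sup>2 \<le> inner (B x) x}"
  have b: "b \<in> S" using below by (simp add: S_def)
  have up: "l \<le> inner (B x0) x0 / (norm x0)\<^sup>2" if "l \<in> S" for l
    using that x0 n0 by (simp add: S_def pos_le_divide_eq)
  then have bdd: "bdd_above S" by (rule bdd_aboveI)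
  define m where "m = Sup S"
  have "m \<le> inner (B x0) x0 / (norm x0)\<^sup>2"
    unfolding m_def using b up by (intro cSup_least) auto
  also have "\<dots> < 0" using neg n0 by (simp add: divide_neg_pos)
  finally have m0: "m < 0" .
  have m_S: "m * (norm x)\<^sup>2 \<le> inner (B x) x" if "x \<in> D" for x
  proof (cases "x = 0")
    case False
    have "m \<le> inner (B x) x / (norm x)\<^sup>2"
      unfolding m_def using b
      by (intro cSup_least) (use that False in \<open>auto simp: S_def pos_le_divide_eq\<close>)
    then show ?thesis using False by (simp add: pos_le_divide_eq)
  qed simp
  define T where "T x = B x - m *\<^sub>R x" for x
  have "m \<in> op_resolvent_set D B" using spec m0 unfolding op_spectrum_def by (metis DiffI UNIV_I less_asym)
  then have bij: "bij_betw T D UNIV" and lin: "bounded_linear (inv_into D T)"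
    by (simp_all add: op_resolvent_set_def T_def[abs_def])
  have T_sym: "\<forall>x\<in>D. \<forall>y\<in>D. inner (T x) y = inner x (T y)"
    using sym by (simp add: T_def inner_diff_left inner_diff_right)
  define Q where "Q = inv_into D T"
  note Q = inv_into_symmetric[OF bij T_sym, folded Q_def]
  obtain C where C: "0 < C" "\<And>x. norm (Q x) \<le> norm x * C"
    using bounded_linear.pos_bounded[OF lin] unfolding Q_def by blast
  have Q_nonneg: "0 \<le> inner (Q a) a" for a
  proof -
    have "inner (Q a) a = inner (T (Q a)) (Q a)" by (simp add: Q(2) inner_commute)
    then show ?thesis using m_S[OF Q(1), of a] by (simp add: T_def inner_diff_left dot_square_norm)
  qed
  \<comment> \<open>The positive form of \<open>Q\<close> is evaluated at \<open>T x - s x\<close>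
    with \<open>Q \<le> C\<close>. The value \<open>s = 1 / C\<close> minimises the resulting
    quadratic in \<open>s\<close> and yields
    \<open>inner x (T x) \<ge> norm x ^ 2 / C\<close>.\<close>
  have "m + 1 / C \<in> S"
    unfolding S_def
  proof (intro CollectI ballI)
    fix x assume x: "x \<in> D"
    have Qx: "inner (Q x) x \<le> C * (norm x)\<^sup>2"
      using norm_cauchy_schwarz[of "Q x" x] mult_right_mono[OF C(2)[of x], of "norm x"]
      by (simp add: power2_eq_square ac_simps)
    have lQ: "Q (a - s *\<^sub>R b) = Q a - s *\<^sub>R Q b" for a b s
      using lin unfolding Q_def by (simp add: bounded_linear.linear linear_diff linear_scale)
    have QT: "Q (T x) = x" by (rule Q(3)[OF x])
    have "0 \<le> inner (Q (T x - (1 / C) *\<^sub>R x)) (T x - (1 / C) *\<^sub>R x)" by (rule Q_nonneg)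
    also have "\<dots> = inner x (T x) - 2 / C * inner x x + (1 / C)\<^sup>2 * inner (Q x) x"
    proof -
      have "inner (Q x) (T x) = inner x x" using Q(4)[of x "T x"] QT by simp
      then show ?thesis
        by (simp add: lQ QT inner_diff_left inner_diff_right power2_eq_square diff_divide_distrib)
    qed
    also have "\<dots> \<le> inner x (T x) - 2 / C * inner x x + (1 / C)\<^sup>2 * (C * (norm x)\<^sup>2)"
      using Qx by (intro add_left_mono mult_left_mono) auto
    also have "\<dots> = inner x (T x) - (norm x)\<^sup>2 / C"
      using C(1) by (simp add: dot_square_norm field_simps power2_eq_square)
    also have "inner x (T x) = inner (B x) x - m * (norm x)\<^sup>2"
      by (simp add: T_def inner_diff_right dot_square_norm inner_commute)
    finally show "(m + 1 / C) * (norm x)\<^sup>2 \<le> inner (B x) x" by (simp add: algebra_simps)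
  qed
  then have "m + 1 / C \<le> m" unfolding m_def by (rule cSup_upper[OF _ bdd])
  then show False using C(1) by simp
qed

text \<open>Positivity of the spectrum enters twice: 0 is in the resolvent set, so \<open>R\<close>
  exists and is bounded, and the form of \<open>B\<close> is nonnegative, so \<open>R\<close> is
  positive. Any positive bound for the norm of \<open>R\<close> serves as \<open>c\<close>.\<close>

lemma ex_shifted_self_adjoint_operator:
  fixes D :: "'a::{real_inner,complete_space} set"
  assumes sa: "self_adjoint_op D A" and bb: "bounded_below_op D A" and k: "0 \<le> k"
    and spec: "\<forall>l\<in>op_spectrum D (\<lambda>x. A x + k *\<^sub>R x). 0 < l"
  obtains R c where "shifted_self_adjoint_operator R c D A k"
proof -
  define B where "B x = A x + k *\<^sub>R x" for x
  have A_sym: "inner (A x) y = inner x (A y)" if "x \<in> D" "y \<in> D" for x y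
    using sa that unfolding self_adjoint_op_def by blast
  have B_sym: "\<forall>x\<in>D. \<forall>y\<in>D. inner (B x) y = inner x (B y)"
    using A_sym by (simp add: B_def inner_add_left inner_add_right)
  obtain b where b: "\<forall>x\<in>D. b * (norm x)\<^sup>2 \<le> inner (A x) x" using bb by (auto simp: bounded_below_op_def)
  have spec': "\<forall>l\<in>op_spectrum D B. 0 < l" using spec by (simp add: B_def[abs_def])
  have B_nonneg: "0 \<le> inner (B x) x" if "x \<in> D" for x
    by (rule form_nonneg_if_spectrum_pos[OF B_sym _ spec' that, of "b + k"])
       (use b in \<open>auto simp: B_def inner_add_left dot_square_norm algebra_simps\<close>)
  have "0 \<in> op_resolvent_set D B" using spec' unfolding op_spectrum_def by (metis DiffI UNIV_I less_irrefl)
  then have bij: "bij_betw B D UNIV" and lin: "bounded_linear (inv_into D B)"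
    by (simp_all add: op_resolvent_set_def)
  define R where "R = inv_into D B"
  note R = inv_into_symmetric[OF bij B_sym, folded R_def]
  obtain c where c: "0 < c" "\<And>x. norm (R x) \<le> norm x * c"
    using bounded_linear.pos_bounded[OF lin] unfolding R_def by blast
  have "shifted_self_adjoint_operator R c D A k"
  proof (intro shifted_self_adjoint_operator.intro shifted_self_adjoint_operator_axioms.intro
      shifted_positive_operator.intro shifted_positive_operator_axioms.intro positive_operator.intro)
    show "linear R" using lin unfolding R_def by (rule bounded_linear.linear)
    show "inner (R x) y = inner x (R y)" for x y by (rule R(4))
    show "0 \<le> inner (R x) x" for x
      using B_nonneg[OF R(1), of x] by (simp add: R(2) inner_commute)
    show "inner (R x) x \<le> c * inner x x" for x
      using norm_cauchy_schwarz[of "R x" x] mult_right_mono[OF c(2)[of x], of "norm x"]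
      by (simp add: dot_square_norm power2_eq_square ac_simps)
    show "A (R x) + k *\<^sub>R R x = x" for x using R(2)[of x] by (simp add: B_def)
    show "R (A y + k *\<^sub>R y) = y" if "y \<in> D" for y using R(3)[OF that] by (simp add: B_def)
    show "closure D = UNIV" using sa unfolding self_adjoint_op_def by blast
    show "y \<in> D \<and> A y = z" if "\<And>x. x \<in> D \<Longrightarrow> inner (A x) y = inner x z" for y z
      using sa that unfolding self_adjoint_op_def by blast
  qed (use c k R(1) in auto)
  then show thesis by (rule that)
qed

section \<open>Total boundedness of the invariant set in the graph norm\<close>

theorem theorem3p2:
  fixes D :: "'a::{real_inner,complete_space} set"
    and A :: "'a \<Rightarrow> 'a" and g :: "'a \<Rightarrow> 'a"
    and kbar \<alpha> :: real and K :: "'a set"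
  assumes sa: "self_adjoint_op D A"
    and bb: "bounded_below_op D A"
    and kbar: "kbar \<ge> 0"
    and spec: "\<forall>l\<in>op_spectrum D (\<lambda>x. A x + kbar *\<^sub>R x). l > 0"
    and alpha: "0 \<le> \<alpha>" "\<alpha> < 1"
    and lip: "\<forall>M. M \<subseteq> frac_space D (\<lambda>x. A x + kbar *\<^sub>R x) \<alpha> \<and>
                   bounded (frac_pow D (\<lambda>x. A x + kbar *\<^sub>R x) \<alpha> ` M) \<longrightarrow>
                (\<exists>L. \<forall>u\<in>M. \<forall>v\<in>M. norm (g u - g v) \<le>
                   L * norm (frac_pow D (\<lambda>x. A x + kbar *\<^sub>R x) \<alpha> u - frac_pow D (\<lambda>x. A x + kbar *\<^sub>R x) \<alpha> v))"
    and inv: "pi_invariant D A kbar \<alpha> g K"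
    and Ksub: "K \<subseteq> frac_space D (\<lambda>x. A x + kbar *\<^sub>R x) \<alpha>"
    and Kcpt: "compact (frac_pow D (\<lambda>x. A x + kbar *\<^sub>R x) \<alpha> ` K)"
  shows "K \<subseteq> D \<and> compact ((\<lambda>x. A x + kbar *\<^sub>R x) ` K)"
proof -
  obtain R c where "shifted_self_adjoint_operator R c D A kbar"
    using ex_shifted_self_adjoint_operator[OF sa bb kbar spec] .
  then interpret shifted_self_adjoint_operator R c D A kbar .
  define B where "B = (\<lambda>x. A x + kbar *\<^sub>R x)"
  define W where "W = frac_pow D B \<alpha>"
  define P where "P = frac_neg_power D B \<alpha>"
  obtain \<kappa> where \<kappa>: "\<kappa> \<noteq> 0" and P: "\<And>x. P x = \<kappa> *\<^sub>R phi (power_symbol \<alpha>) x"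
  proof (cases "\<alpha> = 0")
    case True
    then show thesis
      by (intro that[of 1]) (simp_all add: P_def frac_neg_power_def power_symbol_def[abs_def] phi_1)
  next
    case False
    obtain \<kappa> where "\<kappa> \<noteq> 0" "\<And>x. frac_neg_power D (\<lambda>x. A x + kbar *\<^sub>R x) \<alpha> x = \<kappa> *\<^sub>R phi (\<lambda>r. r powr \<alpha>) x"
      using frac_neg_power_eq_phi[of \<alpha>] False alpha by (metis less_eq_real_def)
    with False show thesis
      by (intro that[of \<kappa>]) (simp_all add: P_def B_def power_symbol_def[abs_def])
  qed
  have P_cont: "continuous_on S P" for S
    unfolding P by (intro continuous_on_scaleR continuous_on_const linear_continuous_on
        bounded_linear_phi continuous_on_power_symbol alpha)
  have PW: "P (W x) = x" if "x \<in> K" for x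
    using that Ksub unfolding W_def P_def frac_pow_def frac_space_def B_def by (auto intro: f_inv_into_f)
  have WK: "compact (W ` K)" using Kcpt by (simp add: W_def B_def)
  \<comment> \<open>\<open>P\<close> is continuous on the whole space, so compactness in the norm of
    the fractional power space passes to the weaker norm.\<close>
  have "K = P ` W ` K" using PW by force
  then have K: "compact K" using compact_continuous_image[OF P_cont WK] by simp
  obtain L0 where L0: "\<And>x y. x \<in> K \<Longrightarrow> y \<in> K \<Longrightarrow> norm (g x - g y) \<le> L0 * norm (W x - W y)"
    using lip[rule_format, of K] Ksub compact_imp_bounded[OF Kcpt] unfolding W_def B_def by blast
  define L where "L = \<bar>L0\<bar>"
  have L_nonneg: "0 \<le> L" by (simp add: L_def)
  have L: "norm (g x - g y) \<le> L * norm (W x - W y)" if "x \<in> K" "y \<in> K" for x y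
    using L0[OF that] mult_right_mono[OF abs_ge_self[of L0] norm_ge_zero[of "W x - W y"]] unfolding L_def by linarith
  have gK: "compact (g ` K)"
  proof -
    \<comment> \<open>The map \<open>g\<close> is Lipschitz only with respect to the fractional
      norm, so its continuity is used on the compact image of \<open>K\<close> under
      \<open>W\<close>, with \<open>P\<close> leading back to \<open>K\<close>.\<close>
    have "continuous_on (W ` K) (\<lambda>w. g (P w))"
    proof (rule lipschitz_on_continuous_on[OF lipschitz_onI])
      show "dist (g (P a)) (g (P b)) \<le> L * dist a b" if "a \<in> W ` K" "b \<in> W ` K" for a b
        using that L PW by (auto simp: dist_norm)
      show "0 \<le> L" by (rule L_nonneg)
    qed
    then have "compact ((\<lambda>w. g (P w)) ` W ` K)" by (rule compact_continuous_image[OF _ WK])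
    moreover have "(\<lambda>w. g (P w)) ` W ` K = g ` K" using PW by force
    ultimately show ?thesis by simp
  qed
  obtain M where M: "0 < M" "\<And>x. x \<in> K \<Longrightarrow> norm (g x) \<le> M"
    using compact_imp_bounded[OF gK] unfolding bounded_pos by blast
  obtain N where N: "0 < N" "\<And>x. x \<in> K \<Longrightarrow> norm x \<le> N"
    using compact_imp_bounded[OF K] unfolding bounded_pos by blast
  obtain C \<theta> where \<theta>: "0 < \<theta>" and C: "0 \<le> C"
    and main: "\<forall>u w f t. mild \<alpha> \<kappa> M N L u w f \<longrightarrow> u t \<in> D \<and>
      (\<forall>\<tau>. 0 < \<tau> \<longrightarrow> \<tau> \<le> 1 \<longrightarrow>
        norm (A (u t) + kbar *\<^sub>R u t - (phi (weighted_symbol kbar 1 \<tau>) (u (t - \<tau>))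
           + (f t - phi (semigroup_symbol kbar \<tau>) (f t)))) \<le> C * \<tau> powr \<theta>)"
    using mild_in_domain[OF alpha \<kappa> less_imp_le[OF M(1)] less_imp_le[OF N(1)] L_nonneg] by (elim exE conjE)
  have mild: "\<exists>\<sigma>. mild \<alpha> \<kappa> M N L \<sigma> (\<lambda>t. W (\<sigma> t)) (\<lambda>t. g (\<sigma> t)) \<and> range \<sigma> \<subseteq> K \<and> \<sigma> 0 = x" if x: "x \<in> K" for x
  proof -
    obtain \<sigma> where sol: "is_solution D A kbar \<alpha> g UNIV \<sigma>" and \<sigma>: "range \<sigma> \<subseteq> K" "\<sigma> 0 = x"
      using bspec[OF inv[unfolded pi_invariant_def] x] by (elim exE conjE)
    have \<sigma>K: "\<sigma> t \<in> K" for t using \<sigma>(1) by blast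
    have "mild \<alpha> \<kappa> M N L \<sigma> (\<lambda>t. W (\<sigma> t)) (\<lambda>t. g (\<sigma> t))"
      unfolding mild_def
    proof (intro conjI allI impI)
      show "\<sigma> t = \<kappa> *\<^sub>R phi (power_symbol \<alpha>) (W (\<sigma> t))" for t using PW[OF \<sigma>K[of t]] by (simp add: P)
      show "((\<lambda>s. op_semigroup D A (t - s) (g (\<sigma> s))) has_integral
         (\<sigma> t - op_semigroup D A (t - t0) (\<sigma> t0))) {t0..t}" if "t0 \<le> t" for t0 t
        using sol that by (simp add: is_solution_def Let_def)
    qed (use M N L \<sigma>K in auto)
    with \<sigma> show ?thesis by blast
  qed
  have KD: "K \<subseteq> D" using mild main by blast
  \<comment> \<open>Closedness of the image under the unbounded \<open>B\<close> becomes closedness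
    of a preimage under the bounded \<open>R\<close>.\<close>
  have "B ` K = R -` K"
  proof (intro set_eqI iffI)
    fix y assume "y \<in> B ` K"
    then show "y \<in> R -` K" using KD R_A by (auto simp: B_def)
  next
    fix y assume "y \<in> R -` K"
    then show "y \<in> B ` K" using A_R[of y] by (force simp: B_def)
  qed
  moreover have "closed (R -` K)"
  proof (rule closed_vimage)
    show "continuous_on UNIV R"
      using linear_continuous_on[OF bounded_linear_phi[OF continuous_on_id]] by (simp add: phi_id[abs_def])
  qed (rule compact_imp_closed[OF K])
  ultimately have closed: "closed (B ` K)" by simp
  have "\<exists>F. finite F \<and> B ` K \<subseteq> (\<Union>x\<in>F. ball x e)" if e: "0 < e" for e
  proof -
    have "((\<lambda>\<tau>. C * \<tau> powr \<theta>) \<longlongrightarrow> C * 0 powr \<theta>) (at_right 0)"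
      using \<theta> by (intro tendsto_intros tendsto_powr2) (auto simp: eventually_at_filter)
    then have "\<forall>\<^sub>F \<tau> in at_right 0. C * \<tau> powr \<theta> < e / 2"
      using e by (intro order_tendstoD) auto
    moreover have "\<forall>\<^sub>F \<tau> in at_right (0::real). 0 < \<tau>" by (rule eventually_at_right_less)
    moreover have "\<forall>\<^sub>F \<tau> in at_right (0::real). \<tau> < 1" by (rule eventually_at_right_real[OF zero_less_one, THEN eventually_mono]) simp
    ultimately have "\<forall>\<^sub>F \<tau> in at_right 0. C * \<tau> powr \<theta> < e / 2 \<and> 0 < \<tau> \<and> \<tau> < 1"
      by eventually_elim simp
    then obtain \<tau> where \<tau>: "C * \<tau> powr \<theta> < e / 2" "0 < \<tau>" "\<tau> < 1"
      using eventually_happens trivial_limit_at_right_real[of 0] by blast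
    \<comment> \<open>\<open>Z\<close> allows arbitrary pairs of points of \<open>K\<close>, whether
      or not a solution links them. It therefore contains the approximants of all solutions in
      \<open>K\<close> at once and is compact as a sum of two compact sets.\<close>
    define Z where "Z = {a + b |a b. a \<in> phi (weighted_symbol kbar 1 \<tau>) ` K
        \<and> b \<in> (\<lambda>b. b - phi (semigroup_symbol kbar \<tau>) b) ` g ` K}"
    have "compact Z"
      unfolding Z_def using \<tau>
      by (intro compact_sums compact_continuous_image K gK continuous_on_diff continuous_on_id linear_continuous_on
          bounded_linear_phi continuous_on_weighted_symbol continuous_on_semigroup_symbol) auto
    then obtain F where F: "finite F" "Z \<subseteq> (\<Union>x\<in>F. ball x (e / 2))"
      using e by (metis compact_eq_totally_bounded half_gt_zero)
    have "B ` K \<subseteq> (\<Union>x\<in>F. ball x e)"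
    proof
      fix y assume "y \<in> B ` K"
      then obtain x where x: "x \<in> K" "y = B x" by auto
      obtain \<sigma> where \<sigma>: "mild \<alpha> \<kappa> M N L \<sigma> (\<lambda>t. W (\<sigma> t)) (\<lambda>t. g (\<sigma> t))" "range \<sigma> \<subseteq> K" "\<sigma> 0 = x"
        using mild[OF x(1)] by blast
      \<comment> \<open>The solution is read at time 0, where it passes through \<open>x\<close>; by
        invariance its value at \<open>- \<tau>\<close> is again in \<open>K\<close>, which puts
        \<open>z\<close> into \<open>Z\<close>.\<close>
      define z where "z = phi (weighted_symbol kbar 1 \<tau>) (\<sigma> (0 - \<tau>)) + (g x - phi (semigroup_symbol kbar \<tau>) (g x))"
      have "norm (y - z) \<le> C * \<tau> powr \<theta>"
        using main[rule_format, OF \<sigma>(1), of 0] \<tau> by (simp add: \<sigma>(3) x(2) B_def z_def)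
      then have yz: "dist z y < e / 2" using \<tau> by (simp add: dist_norm norm_minus_commute)
      have "z \<in> Z" unfolding Z_def z_def using \<sigma>(2) x(1) by blast
      then obtain q where q: "q \<in> F" "dist q z < e / 2" using F by auto
      then have "dist q y < e" using yz dist_triangle[of q y z] by linarith
      with q show "y \<in> (\<Union>x\<in>F. ball x e)" by auto
    qed
    with F show ?thesis by blast
  qed
  with closed have "compact (B ` K)" by (simp add: compact_eq_totally_bounded complete_eq_closed)
  with KD show ?thesis by (simp add: B_def)
qed

end
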